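(* For every integer $d\ge3$ there exists a constant $c>0$ such that for every prime power $q$, if $P$ is a point set of size at least $cq^{d-2}$ in $\mathbb{F}^d_q$, then $P$ contains a critical coplanar $(d+1)$-tuple.
   Context: $\mathbb{F}_q$ is the finite field with $q$ elements. A hyperplane in $\mathbb{F}_q^d$ is a $(d-1)$-dimensional affine subspace. A coplanar $(d+1)$-tuple is a set of $d+1$ distinct points contained in some hyperplane; it is critical if every proper subset of it is affinely independent. *)

theory Defs
  imports
    "HOL-Number_Theory.Prime_Powers"
    "HOL-Algebra.Weak_Morphisms"
    "Jordan_Normal_Form.Missing_VectorSpace"
begin

text \<open>
  Vector spaces are those of \<^locale>\<open>vectorspace\<close>, whose scalar field is a record, because in the
  theorem the field is quantified inside the scope of an existentially quantified constant.
\<close>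

context vectorspace
begin

text \<open>Any base point would do: the condition does not depend on the choice of \<open>a\<close>.\<close>
definition affinely_independent :: "'c set \<Rightarrow> bool" where
  "affinely_independent A \<longleftrightarrow>
     A \<subseteq> carrier V \<and> (\<forall>a\<in>A. lin_indpt ((\<lambda>x. x \<ominus>\<^bsub>V\<^esub> a) ` (A - {a})))"

text \<open>
  The conjunct \<open>fin_dim\<close> is needed because \<open>dim\<close> is an unspecified number for spaces that are
  not finite-dimensional.
\<close>
definition affine_subspace_of_dim :: "nat \<Rightarrow> 'c set \<Rightarrow> bool" where
  "affine_subspace_of_dim k A \<longleftrightarrow>
     (\<exists>v\<in>carrier V. \<exists>W. VectorSpace.subspace K W V \<and>
        vectorspace.fin_dim K (vs W) \<and> vectorspace.dim K (vs W) = k \<and>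
        A = (\<lambda>w. v \<oplus>\<^bsub>V\<^esub> w) ` W)"

end

text \<open>Points have coordinates indexed by \<open>0, \<dots>, d - 1\<close> and are \<open>undefined\<close> at other indices.\<close>
definition coord_space :: "('a, 'm) ring_scheme \<Rightarrow> nat \<Rightarrow> ('a, nat \<Rightarrow> 'a) module" where
  "coord_space F d = ring.func_space F {..<d}"

lemma coord_space_vectorspace:
  assumes "field F"
  shows "vectorspace F (coord_space F d)"
proof -
  interpret field F by fact
  interpret vectorspace F "coord_space F d"
    unfolding coord_space_def vectorspace_def
    using func_space_is_module assms by blast
  show ?thesis ..
qed

text \<open>Intended for \<open>d \<ge> 1\<close>, where \<open>d - 1\<close> is not truncated.\<close>
definition hyperplane :: "('a, 'm) ring_scheme \<Rightarrow> nat \<Rightarrow> (nat \<Rightarrow> 'a) set \<Rightarrow> bool" where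
  "hyperplane F d H \<longleftrightarrow> vectorspace.affine_subspace_of_dim F (coord_space F d) (d - 1) H"

text \<open>Tuples are sets of distinct points; \<open>card T = d + 1\<close> implies that \<open>T\<close> is finite.\<close>
definition coplanar_tuple :: "('a, 'm) ring_scheme \<Rightarrow> nat \<Rightarrow> (nat \<Rightarrow> 'a) set \<Rightarrow> bool" where
  "coplanar_tuple F d T \<longleftrightarrow> card T = d + 1 \<and> (\<exists>H. hyperplane F d H \<and> T \<subseteq> H)"

definition critical_coplanar_tuple :: "('a, 'm) ring_scheme \<Rightarrow> nat \<Rightarrow> (nat \<Rightarrow> 'a) set \<Rightarrow> bool" where
  "critical_coplanar_tuple F d T \<longleftrightarrow> coplanar_tuple F d T \<and>
     (\<forall>S. S \<subset> T \<longrightarrow> vectorspace.affinely_independent F (coord_space F d) S)"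

text \<open>
  A type cannot be quantified inside a formula, so the theorem ranges over the finite fields whose
  elements are natural numbers. By the following lemma this covers every finite field up to
  isomorphism.
\<close>
lemma finite_field_iso_nat:
  fixes F :: "('a, 'm) ring_scheme"
  assumes "field F" and "finite (carrier F)"
  shows "\<exists>G :: nat ring. field G \<and> (\<exists>h. h \<in> ring_iso F G)"
proof -
  interpret field F by fact
  obtain f :: "'a \<Rightarrow> nat" where f: "inj_on f (carrier F)"
    using finite_imp_inj_to_nat_seg[OF assms(2)] by blast
  show ?thesis
    using inj_imp_image_ring_is_field[OF f] inj_imp_image_ring_iso[OF f] by blast
qed

end

theory Submission
  imports Defs
begin

text \<open>
  In homogeneous coordinates, with \<open>r = d + 1\<close>, the set \<open>P\<close> becomes a set \<open>S\<close> of pairwise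
  non-parallel vectors of \<open>F^r\<close>, and a critical coplanar tuple becomes a circuit of size \<open>r\<close>.

  Let \<open>C\<close> be a circuit of size \<open>k\<close> in \<open>S\<close> with \<open>3 \<le> k < r\<close>, with relation \<open>\<Sum> a x \<cdot> x = 0\<close>, and let
  \<open>p\<close>, \<open>p'\<close> be two points of \<open>S\<close> off \<open>span C\<close> with \<open>p' = l p + \<Sum> c x a x \<cdot> x\<close>. The function \<open>c\<close> is
  determined up to an additive constant; if it takes some value exactly once, at \<open>x1\<close>, then shifting
  that value to zero shows that \<open>C - {x1} \<union> {p, p'}\<close> is a circuit of size \<open>k + 1\<close>. So if \<open>S\<close> has no
  such circuit, then for each \<open>p\<close> only the \<open>O(q^(k-3))\<close> functions without a unique value occur.
  As there are \<open>O(q^(r-k))\<close> classes of points modulo \<open>span C\<close>, this leaves \<open>O(q^(r-3))\<close> points off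
  \<open>span C\<close>, and \<open>span C\<close> itself contains only \<open>O(q^(k-2))\<close> points of \<open>S\<close>. Hence a larger \<open>S\<close> that
  contains a circuit of size \<open>k\<close> contains one of size \<open>k + 1\<close>. Some circuit of size at most \<open>r\<close>
  exists, since otherwise each of the \<open>q + 1\<close> hyperplanes through \<open>r - 2\<close> points of \<open>S\<close> contains
  at most one further point of \<open>S\<close>.
\<close>

subsection \<open>Circuits\<close>

context vectorspace
begin

lemma lincomb_supported_subset:
  assumes "finite B" "B \<subseteq> carrier V" "A \<subseteq> B" "a \<in> B \<rightarrow> carrier K"
    and "\<And>x. x \<in> B - A \<Longrightarrow> a x = \<zero>\<^bsub>K\<^esub>"
  shows "lincomb a B = lincomb a A"
proof -
  have "lincomb a (A \<union> (B - A)) = lincomb a A"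
    by (rule lincomb_clean) (use assms finite_subset[of A B] in auto)
  moreover have "A \<union> (B - A) = B" using assms by auto
  ultimately show ?thesis by simp
qed

text \<open>Circuits of the linear matroid on \<open>carrier V\<close>. Deleting single elements
  suffices for minimality, since subsets of independent sets are independent.\<close>

definition circuit :: "'c set \<Rightarrow> bool" where
  "circuit C \<longleftrightarrow> finite C \<and> C \<subseteq> carrier V \<and> lin_dep C \<and> (\<forall>x\<in>C. lin_indpt (C - {x}))"

lemma circuitD:
  assumes "circuit C"
  shows "finite C" "C \<subseteq> carrier V" "lin_dep C" "x \<in> C \<Longrightarrow> lin_indpt (C - {x})"
  using assms by (auto simp: circuit_def)

lemma lin_indptD:
  assumes "lin_indpt A" "finite A" "a \<in> A \<rightarrow> carrier K" "lincomb a A = \<zero>\<^bsub>V\<^esub>" "x \<in> A"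
  shows "a x = \<zero>\<^bsub>K\<^esub>"
  using lin_dep_crit[OF assms(2) subset_refl assms(3,5) _ assms(4)] assms(1) by blast

text \<open>A relation on \<open>C\<close> that vanishes at \<open>x\<close> is a relation on the
  independent set \<open>C - {x}\<close>. So a nontrivial relation on a circuit has full
  support.\<close>

lemma circuit_relation_eq_zero:
  assumes "circuit C" "b \<in> C \<rightarrow> carrier K" "lincomb b C = \<zero>\<^bsub>V\<^esub>" "x \<in> C" "b x = \<zero>\<^bsub>K\<^esub>" "y \<in> C"
  shows "b y = \<zero>\<^bsub>K\<^esub>"
proof (cases "y = x")
  case False
  have "lincomb b C = lincomb b (C - {x})"
    by (rule lincomb_supported_subset) (use assms circuitD[OF assms(1)] in auto)
  then show ?thesis
    using lin_indptD[of "C - {x}" b y] assms circuitD[OF assms(1)] False by auto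
qed (use assms in auto)

lemma circuit_relation:
  assumes "circuit C"
  obtains a where "a \<in> C \<rightarrow> carrier K" "lincomb a C = \<zero>\<^bsub>V\<^esub>" "\<And>x. x \<in> C \<Longrightarrow> a x \<noteq> \<zero>\<^bsub>K\<^esub>"
  using finite_lin_dep[OF circuitD(1,3,2)[OF assms]] circuit_relation_eq_zero[OF assms] by metis

text \<open>Independence of \<open>E - {z}\<close> makes the relations on \<open>E\<close> a line
  spanned by \<open>b\<close>: subtracting the multiple of \<open>b\<close> that agrees at
  \<open>z\<close> leaves a relation on \<open>E - {z}\<close>. As \<open>b\<close> vanishes
  nowhere, a relation that vanishes at some \<open>y\<close> is the zero multiple of
  \<open>b\<close>.\<close>

lemma circuitI:
  assumes "finite E" "E \<subseteq> carrier V" "b \<in> E \<rightarrow> carrier K" "lincomb b E = \<zero>\<^bsub>V\<^esub>"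
    and nz: "\<And>x. x \<in> E \<Longrightarrow> b x \<noteq> \<zero>\<^bsub>K\<^esub>" and z: "z \<in> E" "lin_indpt (E - {z})"
  shows "circuit E"
  unfolding circuit_def
proof (intro conjI ballI)
  show "lin_dep E" using lin_dep_crit[OF assms(1) subset_refl assms(3) z(1) nz[OF z(1)] assms(4)] .
  fix y assume y: "y \<in> E"
  show "lin_indpt (E - {y})"
  proof (rule finite_lin_indpt2)
    fix e assume e: "e \<in> E - {y} \<rightarrow> carrier K" "lincomb e (E - {y}) = \<zero>\<^bsub>V\<^esub>"
    \<comment> \<open>A relation on \<open>E - {y}\<close> is extended by zero to one on
      \<open>E\<close>.\<close>
    define e' where "e' = (\<lambda>x. if x = y then \<zero>\<^bsub>K\<^esub> else e x)"
    have e'c: "e' \<in> E \<rightarrow> carrier K" using e by (auto simp: e'_def)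
    have "lincomb e' E = lincomb e' (E - {y})"
      by (rule lincomb_supported_subset) (use assms e'c in \<open>auto simp: e'_def\<close>)
    also have "\<dots> = lincomb e (E - {y})"
      by (rule lincomb_cong) (use assms e in \<open>auto simp: e'_def\<close>)
    finally have e'0: "lincomb e' E = \<zero>\<^bsub>V\<^esub>" using e by simp
    \<comment> \<open>This factor makes \<open>e'\<close> and \<open>t\<close> times
      \<open>b\<close> agree at \<open>z\<close>, so that their difference \<open>f\<close> is
      supported on \<open>E - {z}\<close>.\<close>
    define t where "t = e' z \<otimes>\<^bsub>K\<^esub> inv\<^bsub>K\<^esub> b z"
    have bz: "b z \<in> Units K" using z nz assms(3) field_Units by auto
    have t: "t \<in> carrier K" using bz e'c z by (auto simp: t_def)
    define f where "f = (\<lambda>x. e' x \<ominus>\<^bsub>K\<^esub> t \<otimes>\<^bsub>K\<^esub> b x)"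
    have tb: "(\<lambda>x. t \<otimes>\<^bsub>K\<^esub> b x) \<in> E \<rightarrow> carrier K" using t assms(3) by auto
    have fc: "f \<in> E \<rightarrow> carrier K" using e'c tb by (auto simp: f_def)
    have "lincomb f E = lincomb e' E \<ominus>\<^bsub>V\<^esub> lincomb (\<lambda>x. t \<otimes>\<^bsub>K\<^esub> b x) E"
      unfolding f_def by (rule lincomb_diff) (use assms e'c tb in auto)
    also have "\<dots> = \<zero>\<^bsub>V\<^esub>"
      using lincomb_smult[of E b t] assms t e'0 by (simp add: M.minus_eq)
    finally have f0: "lincomb f E = \<zero>\<^bsub>V\<^esub>" .
    have bzc: "b z \<in> carrier K" "e' z \<in> carrier K" using assms e'c by auto
    have "t \<otimes>\<^bsub>K\<^esub> b z = e' z"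
      unfolding t_def using bz bzc by (simp add: R.m_assoc)
    then have fz: "f z = \<zero>\<^bsub>K\<^esub>" unfolding f_def using bzc by (simp add: R.minus_eq R.r_neg)
    have f0': "f x = \<zero>\<^bsub>K\<^esub>" if "x \<in> E" for x
    proof (cases "x = z")
      case False
      have "lincomb f E = lincomb f (E - {z})"
        by (rule lincomb_supported_subset) (use assms fc fz in auto)
      then show ?thesis
        using lin_indptD[of "E - {z}" f x] assms fc f0 False that by auto
    qed (use fz in simp)
    have eq: "e' x = t \<otimes>\<^bsub>K\<^esub> b x" if "x \<in> E" for x
    proof -
      have "e' x \<in> carrier K" "t \<otimes>\<^bsub>K\<^esub> b x \<in> carrier K" using that e'c tb by auto
      then show ?thesis using f0'[OF that] by (simp add: f_def)
    qed
    have "t \<otimes>\<^bsub>K\<^esub> b y = \<zero>\<^bsub>K\<^esub>" using eq[OF y] by (simp add: e'_def)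
    then have "t = \<zero>\<^bsub>K\<^esub>" using nz[OF y] t assms(3) y integral_iff by auto
    then have "e' x = \<zero>\<^bsub>K\<^esub>" if "x \<in> E" for x using eq[OF that] funcset_mem[OF assms(3) that] by simp
    then show "\<forall>v\<in>E - {y}. e v = \<zero>\<^bsub>K\<^esub>" by (metis DiffD1 DiffD2 e'_def insertI1)
  qed (use assms in auto)
qed (use assms in auto)

text \<open>The circuit relation has a nonzero coefficient at \<open>x\<close>, so it can be solved
  for \<open>x\<close>.\<close>

lemma circuit_span_Diff:
  assumes "circuit C" "x \<in> C"
  shows "span (C - {x}) = span C"
proof -
  obtain a where a: "a \<in> C \<rightarrow> carrier K" "lincomb a C = \<zero>\<^bsub>V\<^esub>" "\<And>x. x \<in> C \<Longrightarrow> a x \<noteq> \<zero>\<^bsub>K\<^esub>"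
    using circuit_relation[OF assms(1)] by blast
  have "x \<in> span (C - {x})"
    by (rule lincomb_isolate(2)) (use a assms circuitD[OF assms(1)] in auto)
  moreover have "C - {x} \<subseteq> carrier V" using circuitD(2)[OF assms(1)] by auto
  ultimately have "span (C - {x}) = span (C - {x} \<union> {x})" by (rule already_in_span[rotated])
  moreover have "C - {x} \<union> {x} = C" using assms by auto
  ultimately show ?thesis by simp
qed

lemma lin_indpt_insert:
  assumes "lin_indpt D" "D \<subseteq> carrier V" "p \<in> carrier V" "p \<notin> span D"
  shows "lin_indpt (insert p D)"
proof -
  have "p \<notin> D" using span_mem assms by auto
  then show ?thesis using lin_dep_iff_in_span[of D p] assms by auto
qed

text \<open>Moving \<open>p'\<close> to the other side of \<open>eq\<close> gives a relation in
  which \<open>x\<close> drops out and every other coefficient is nonzero. Without \<open>p'\<close>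
  the new set is \<open>C - {x}\<close> with \<open>p\<close> added, which is independent because
  \<open>p\<close> lies off \<open>span C\<close>; so \<open>circuitI\<close> applies.\<close>

lemma circuit_exchange:
  assumes C: "circuit C" and p: "p \<in> carrier V" "p \<notin> span C" and p': "p' \<notin> span C" "p \<noteq> p'"
    and l: "l \<in> carrier K" "l \<noteq> \<zero>\<^bsub>K\<^esub>" and g: "g \<in> C \<rightarrow> carrier K"
    and eq: "p' = l \<odot>\<^bsub>V\<^esub> p \<oplus>\<^bsub>V\<^esub> lincomb g C"
    and x: "x \<in> C" "g x = \<zero>\<^bsub>K\<^esub>" and nz: "\<And>y. y \<in> C - {x} \<Longrightarrow> g y \<noteq> \<zero>\<^bsub>K\<^esub>"
  shows "circuit (insert p (insert p' (C - {x})))"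
proof -
  note Cf = circuitD(1,2)[OF C]
  define D where "D = C - {x}"
  have D: "finite D" "D \<subseteq> carrier V" "lin_indpt D" "span D = span C"
    using circuitD[OF C] x circuit_span_Diff[OF C] by (auto simp: D_def)
  have pD: "p \<notin> D" "p' \<notin> D" using p p' span_mem[OF Cf(2)] by (auto simp: D_def)
  have gD: "lincomb g C = lincomb g D"
    by (rule lincomb_supported_subset) (use Cf x g in \<open>auto simp: D_def\<close>)
  have gDc: "lincomb g D \<in> carrier V" using D g by (intro lincomb_closed) (auto simp: D_def)
  have p'c: "p' \<in> carrier V" unfolding eq gD using p l gDc by auto
  \<comment> \<open>The relation has coefficient -1 at \<open>p'\<close>, \<open>l\<close> at
    \<open>p\<close> and \<open>g\<close> on \<open>D\<close>.\<close>
  define b where "b = (\<lambda>y. if y = p' then \<ominus>\<^bsub>K\<^esub> \<one>\<^bsub>K\<^esub> else if y = p then l else g y)"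
  have bc: "b \<in> insert p (insert p' D) \<rightarrow> carrier K" using l g by (auto simp: b_def D_def Pi_iff)
  have bD: "lincomb b D = lincomb g D"
    by (rule lincomb_cong) (use D pD g in \<open>auto simp: b_def D_def\<close>)
  have b1: "lincomb b (insert p D) = p'"
    using lincomb_insert2[of D b p] D p bc pD gD eq bD p'(2) by (auto simp: b_def)
  have "lincomb b (insert p' (insert p D)) = b p' \<odot>\<^bsub>V\<^esub> p' \<oplus>\<^bsub>V\<^esub> p'"
    unfolding b1[symmetric]
    by (subst lincomb_insert2) (use D p bc pD p'c p' b1 in auto)
  also have "\<dots> = \<zero>\<^bsub>V\<^esub>" using p'c by (simp add: b_def smult_l_minus M.l_neg)
  finally have b0: "lincomb b (insert p (insert p' D)) = \<zero>\<^bsub>V\<^esub>" by (simp add: insert_commute)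
  have nzb: "b y \<noteq> \<zero>\<^bsub>K\<^esub>" if "y \<in> insert p (insert p' D)" for y
    using that l nz by (auto simp: b_def D_def)
  have "insert p (insert p' D) - {p'} = insert p D" using pD p' by auto
  moreover have "lin_indpt (insert p D)" using lin_indpt_insert D p by auto
  ultimately show ?thesis unfolding D_def[symmetric]
    by (intro circuitI[where z = p' and b = b]) (use D p p'c bc b0 nzb in auto)
qed

end

subsection \<open>Classes of points modulo a span\<close>

text \<open>Such a \<open>c\<close> vanishes at some \<open>i \<noteq> x0\<close>, and at any third point \<open>j\<close> it repeats a value taken
  at some \<open>l \<noteq> j\<close>; so it is determined by \<open>i\<close>, \<open>l\<close> and its values off \<open>{x0, i, j}\<close>.\<close>
lemma card_functions_without_unique_value:
  fixes Q :: "'a set" and C :: "'b set"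
  assumes Q: "finite Q" and C: "finite C" "3 \<le> card C" and x0: "x0 \<in> C"
  shows "card {c \<in> C \<rightarrow>\<^sub>E Q. c x0 = z \<and> (\<forall>x\<in>C. \<exists>y\<in>C - {x}. c y = c x)}
    \<le> (card C)\<^sup>2 * card Q ^ (card C - 3)"
proof -
  define B where "B = {c \<in> C \<rightarrow>\<^sub>E Q. c x0 = z \<and> (\<forall>x\<in>C. \<exists>y\<in>C - {x}. c y = c x)}"
  have "\<exists>j. j \<in> C - {x0, i}" for i
  proof -
    have "card (C - {x0, i}) \<ge> card C - card {x0, i}" by (intro diff_card_le_card_Diff) auto
    moreover have "card {x0, i} \<le> 2" by (simp add: card_insert_if)
    ultimately have "card (C - {x0, i}) \<noteq> 0" using C by linarith
    then show ?thesis by (metis card.empty ex_in_conv)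
  qed
  then obtain j where j: "\<And>i. j i \<in> C - {x0, i}" by metis
  \<comment> \<open>\<open>G (i, l)\<close> rebuilds \<open>c\<close> from its values off the three
    points: \<open>z\<close> at \<open>x0\<close> and \<open>i\<close>, and at \<open>j i\<close> a
    copy of the value at \<open>l\<close>, which is itself \<open>z\<close> when \<open>l\<close> is
    \<open>x0\<close> or \<open>i\<close>.\<close>
  define G where "G = (\<lambda>(i, l) f x. if x = x0 \<or> x = i then z
    else if x = j i then (if l = x0 \<or> l = i then z else f l) else f x)"
  define F where "F = (\<lambda>i. (C - {x0, i, j i}) \<rightarrow>\<^sub>E Q)"
  have cF: "card (G (i, l) ` F i) \<le> card Q ^ (card C - 3)" if "i \<in> C - {x0}" for i l
  proof -
    have "card {x0, i, j i} = 3" using j[of i] that by (auto simp: card_insert_if)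
    moreover have "{x0, i, j i} \<subseteq> C" using j[of i] that x0 by auto
    ultimately have "card (C - {x0, i, j i}) = card C - 3" by (simp add: card_Diff_subset)
    then have "card (F i) = card Q ^ (card C - 3)"
      unfolding F_def using C by (simp add: card_funcsetE)
    moreover have "finite (F i)" unfolding F_def using C Q by (intro finite_PiE) auto
    ultimately show ?thesis using card_image_le by metis
  qed
  have "B \<subseteq> (\<Union>(i, l)\<in>(C - {x0}) \<times> C. G (i, l) ` F i)"
  proof
    fix c assume "c \<in> B"
    then have c: "c \<in> C \<rightarrow>\<^sub>E Q" "c x0 = z" "\<And>x. x \<in> C \<Longrightarrow> \<exists>y\<in>C - {x}. c y = c x"
      by (auto simp: B_def)
    obtain i where i: "i \<in> C - {x0}" "c i = z" using c x0 by metis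
    obtain l where l: "l \<in> C" "l \<noteq> j i" "c l = c (j i)" using c(3)[of "j i"] j[of i] by auto
    have "c = G (i, l) (restrict c (C - {x0, i, j i}))"
    proof
      fix x
      show "c x = G (i, l) (restrict c (C - {x0, i, j i})) x"
        using c(1,2) i l j[of i] by (auto simp: G_def PiE_def extensional_def)
    qed
    moreover have "restrict c (C - {x0, i, j i}) \<in> F i" using c(1) by (auto simp: F_def)
    ultimately show "c \<in> (\<Union>(i, l)\<in>(C - {x0}) \<times> C. G (i, l) ` F i)" using i l by blast
  qed
  moreover have "finite (\<Union>(i, l)\<in>(C - {x0}) \<times> C. G (i, l) ` F i)"
    using C Q by (auto simp: F_def intro!: finite_PiE)
  ultimately have "card B \<le> card (\<Union>(i, l)\<in>(C - {x0}) \<times> C. G (i, l) ` F i)"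
    by (intro card_mono)
  also have "\<dots> \<le> (\<Sum>il\<in>(C - {x0}) \<times> C. card (case il of (i, l) \<Rightarrow> G (i, l) ` F i))"
    using C by (intro card_UN_le) auto
  also have "\<dots> \<le> (\<Sum>il\<in>(C - {x0}) \<times> C. card Q ^ (card C - 3))"
    by (intro sum_mono) (use cF in auto)
  also have "\<dots> \<le> (card C)\<^sup>2 * card Q ^ (card C - 3)"
    using C by (auto simp: card_cartesian_product power2_eq_square card_Diff_singleton_if)
  finally show ?thesis by (simp add: B_def)
qed

context vectorspace
begin

section \<open>Closure properties and sizes of spans\<close>

lemma span_add_smult:
  assumes "B \<subseteq> carrier V" "u \<in> span B" "w \<in> span B" "c \<in> carrier K"
  shows "c \<odot>\<^bsub>V\<^esub> u \<oplus>\<^bsub>V\<^esub> w \<in> span B"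
  using submodule.smult_closed submodule.m_closed span_is_submodule assms by metis

lemma span_minus:
  assumes "B \<subseteq> carrier V" "u \<in> span B" "w \<in> span B"
  shows "u \<ominus>\<^bsub>V\<^esub> w \<in> span B"
  using assms span_add1 span_neg by (simp add: M.minus_eq)

lemma span_smult_cancel:
  assumes "B \<subseteq> carrier V" "p \<in> carrier V" "c \<in> carrier K" "c \<noteq> \<zero>\<^bsub>K\<^esub>" "c \<odot>\<^bsub>V\<^esub> p \<in> span B"
  shows "p \<in> span B"
proof -
  have "p = inv\<^bsub>K\<^esub> c \<odot>\<^bsub>V\<^esub> (c \<odot>\<^bsub>V\<^esub> p)" using mult_inverse assms by blast
  moreover have "inv\<^bsub>K\<^esub> c \<in> carrier K" using assms field_Units by auto
  ultimately show ?thesis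
    using submodule.smult_closed[OF span_is_submodule[OF assms(1)]] assms(5) by metis
qed

text \<open>Taking linear combinations is a bijection from extensional coefficient functions on
  \<open>B\<close> to the span; independence gives injectivity.\<close>

lemma card_span_lin_indpt:
  assumes "finite B" "B \<subseteq> carrier V" "lin_indpt B" "finite (carrier K)"
  shows "card (span B) = card (carrier K) ^ card B"
proof -
  have "span B = (\<lambda>a. lincomb a B) ` (B \<rightarrow>\<^sub>E carrier K)"
  proof safe
    fix u assume "u \<in> span B"
    then obtain a where a: "a \<in> B \<rightarrow> carrier K" "lincomb a B = u"
      using finite_in_span assms by metis
    have "lincomb (restrict a B) B = u"
      unfolding a(2)[symmetric] by (rule lincomb_cong) (use a assms in auto)
    moreover have "restrict a B \<in> B \<rightarrow>\<^sub>E carrier K" using a by auto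
    ultimately show "u \<in> (\<lambda>a. lincomb a B) ` (B \<rightarrow>\<^sub>E carrier K)" by blast
  qed (use assms in \<open>auto simp: finite_span\<close>)
  moreover have "inj_on (\<lambda>a. lincomb a B) (B \<rightarrow>\<^sub>E carrier K)"
  proof (rule inj_onI)
    fix a b assume ab: "a \<in> B \<rightarrow>\<^sub>E carrier K" "b \<in> B \<rightarrow>\<^sub>E carrier K" "lincomb a B = lincomb b B"
    then have ab': "a \<in> B \<rightarrow> carrier K" "b \<in> B \<rightarrow> carrier K" by auto
    have 0: "lincomb (\<lambda>v. a v \<ominus>\<^bsub>K\<^esub> b v) B = \<zero>\<^bsub>V\<^esub>"
      using lincomb_diff[OF assms(1,2) ab'] ab assms ab' by (simp add: M.minus_eq M.r_neg)
    have "a v = b v" if "v \<in> B" for v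
    proof -
      have "a v \<ominus>\<^bsub>K\<^esub> b v = \<zero>\<^bsub>K\<^esub>"
        by (rule lin_indptD[OF assms(3,1) _ 0 that]) (use ab' in \<open>auto simp: Pi_iff\<close>)
      then show ?thesis using ab' that by (auto simp: Pi_iff)
    qed
    then show "a = b" using ab by (intro PiE_ext) auto
  qed
  ultimately show ?thesis
    using assms by (simp add: card_image card_funcsetE)
qed

lemma card_span_circuit:
  assumes "circuit C" "finite (carrier K)" "C \<noteq> {}"
  shows "card (span C) = card (carrier K) ^ (card C - 1)"
proof -
  obtain x where x: "x \<in> C" using assms by auto
  have "card (span (C - {x})) = card (carrier K) ^ card (C - {x})"
    by (rule card_span_lin_indpt) (use circuitD[OF assms(1)] x assms in auto)
  then show ?thesis using circuit_span_Diff[OF assms(1) x] x circuitD[OF assms(1)] by simp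
qed

text \<open>Off \<open>span B\<close>, this is equality of projective points of the quotient by \<open>span B\<close>.\<close>
definition same_class :: "'c set \<Rightarrow> 'c \<Rightarrow> 'c \<Rightarrow> bool" where
  "same_class B p p' \<longleftrightarrow>
    (\<exists>l\<in>carrier K - {\<zero>\<^bsub>K\<^esub>}. \<exists>w\<in>span B. p' = l \<odot>\<^bsub>V\<^esub> p \<oplus>\<^bsub>V\<^esub> w)"

text \<open>Equate the two expressions for \<open>v\<close> and divide by the coefficient of
  \<open>p'\<close>. This form serves the double count in \<open>card_le_of_class_bound\<close>,
  where points are compared through a common \<open>v\<close>.\<close>

lemma same_class_trans_sym:
  assumes B: "B \<subseteq> carrier V" and p: "p \<in> carrier V" "p' \<in> carrier V"
    and v: "same_class B p v" "same_class B p' v"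
  shows "same_class B p p'"
proof -
  obtain l w where l: "l \<in> carrier K" "l \<noteq> \<zero>\<^bsub>K\<^esub>" "w \<in> span B" "v = l \<odot>\<^bsub>V\<^esub> p \<oplus>\<^bsub>V\<^esub> w"
    using v by (auto simp: same_class_def)
  obtain m u where m: "m \<in> carrier K" "m \<noteq> \<zero>\<^bsub>K\<^esub>" "u \<in> span B" "v = m \<odot>\<^bsub>V\<^esub> p' \<oplus>\<^bsub>V\<^esub> u"
    using v by (auto simp: same_class_def)
  have mU: "m \<in> Units K" using m field_Units by auto
  have c: "w \<in> carrier V" "u \<in> carrier V" using l m B by auto
  have i: "inv\<^bsub>K\<^esub> m \<in> carrier K" "inv\<^bsub>K\<^esub> m \<noteq> \<zero>\<^bsub>K\<^esub>"
    using m mU field_Units R.Units_inv_Units[of m] by auto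
  have "m \<odot>\<^bsub>V\<^esub> p' = l \<odot>\<^bsub>V\<^esub> p \<oplus>\<^bsub>V\<^esub> (w \<ominus>\<^bsub>V\<^esub> u)"
    using l(4) m(4) c p l m
    by (metis M.add.inv_solve_right M.add.m_assoc M.minus_eq M.minus_closed M.a_inv_closed smult_closed)
  then have "p' = inv\<^bsub>K\<^esub> m \<odot>\<^bsub>V\<^esub> (l \<odot>\<^bsub>V\<^esub> p \<oplus>\<^bsub>V\<^esub> (w \<ominus>\<^bsub>V\<^esub> u))"
    using mult_inverse m p by blast
  also have "\<dots> = (inv\<^bsub>K\<^esub> m \<otimes>\<^bsub>K\<^esub> l) \<odot>\<^bsub>V\<^esub> p \<oplus>\<^bsub>V\<^esub> inv\<^bsub>K\<^esub> m \<odot>\<^bsub>V\<^esub> (w \<ominus>\<^bsub>V\<^esub> u)"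
    using i l p c by (simp add: smult_r_distr smult_assoc1)
  finally have "p' = (inv\<^bsub>K\<^esub> m \<otimes>\<^bsub>K\<^esub> l) \<odot>\<^bsub>V\<^esub> p \<oplus>\<^bsub>V\<^esub> inv\<^bsub>K\<^esub> m \<odot>\<^bsub>V\<^esub> (w \<ominus>\<^bsub>V\<^esub> u)" .
  moreover have "inv\<^bsub>K\<^esub> m \<odot>\<^bsub>V\<^esub> (w \<ominus>\<^bsub>V\<^esub> u) \<in> span B"
    using submodule.smult_closed[OF span_is_submodule[OF B]] span_minus[OF B l(3) m(3)] i by metis
  moreover have "inv\<^bsub>K\<^esub> m \<otimes>\<^bsub>K\<^esub> l \<in> carrier K - {\<zero>\<^bsub>K\<^esub>}" using i l integral_iff by auto
  ultimately show ?thesis unfolding same_class_def by blast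
qed

text \<open>Each vector of the class comes from exactly one pair \<open>(l, w)\<close>: two
  representations would put a nonzero multiple of \<open>p\<close>, and hence \<open>p\<close>
  itself, into \<open>span B\<close>.\<close>

lemma card_class:
  assumes B: "B \<subseteq> carrier V" and p: "p \<in> carrier V" "p \<notin> span B" and K: "finite (carrier K)"
  shows "card {v. same_class B p v} = (card (carrier K) - 1) * card (span B)"
proof -
  let ?f = "\<lambda>(l, w). l \<odot>\<^bsub>V\<^esub> p \<oplus>\<^bsub>V\<^esub> w"
  let ?D = "(carrier K - {\<zero>\<^bsub>K\<^esub>}) \<times> span B"
  have "{v. same_class B p v} = ?f ` ?D" by (auto simp: same_class_def image_def)
  moreover have "inj_on ?f ?D"
  proof (rule inj_onI)
    fix x y assume xy: "x \<in> ?D" "y \<in> ?D" "?f x = ?f y"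
    obtain l w m u where x: "x = (l, w)" and y: "y = (m, u)" by (metis surj_pair)
    have l: "l \<in> carrier K" "w \<in> span B" and m: "m \<in> carrier K" "u \<in> span B"
      and eq: "l \<odot>\<^bsub>V\<^esub> p \<oplus>\<^bsub>V\<^esub> w = m \<odot>\<^bsub>V\<^esub> p \<oplus>\<^bsub>V\<^esub> u"
      using xy x y by auto
    have c: "w \<in> carrier V" "u \<in> carrier V" using l m B by auto
    have "(l \<ominus>\<^bsub>K\<^esub> m) \<odot>\<^bsub>V\<^esub> p = l \<odot>\<^bsub>V\<^esub> p \<ominus>\<^bsub>V\<^esub> m \<odot>\<^bsub>V\<^esub> p"
      using l m p by (simp add: R.minus_eq M.minus_eq smult_l_distr smult_l_minus)
    also have "\<dots> = ((l \<odot>\<^bsub>V\<^esub> p \<oplus>\<^bsub>V\<^esub> w) \<ominus>\<^bsub>V\<^esub> w) \<ominus>\<^bsub>V\<^esub> m \<odot>\<^bsub>V\<^esub> p"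
      using l m p c by (simp add: M.minus_eq M.add.m_assoc M.r_neg)
    also have "\<dots> = u \<ominus>\<^bsub>V\<^esub> w"
      unfolding eq using l m p c by (simp add: M.minus_eq M.a_ac M.r_neg1 M.r_neg)
    finally have "(l \<ominus>\<^bsub>K\<^esub> m) \<odot>\<^bsub>V\<^esub> p \<in> span B" using span_minus B l m by auto
    then have "l \<ominus>\<^bsub>K\<^esub> m = \<zero>\<^bsub>K\<^esub>"
      using span_smult_cancel[OF B p(1) R.minus_closed[OF l(1) m(1)]] p(2) by blast
    then have "l = m" using l m by auto
    then show "x = y" using eq c m p x y by simp
  qed
  ultimately show ?thesis using K by (simp add: card_image card_cartesian_product card_Diff_singleton)
qed

text \<open>Double counting of the pairs \<open>(p, v)\<close> with \<open>same_class B p v\<close>.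
  Each \<open>p\<close> occurs with as many \<open>v\<close> as \<open>card_class\<close> says, and
  each \<open>v\<close> with at most \<open>M\<close> points \<open>p\<close>.\<close>

lemma card_le_of_class_bound:
  assumes B: "B \<subseteq> carrier V" and T: "T \<subseteq> carrier V - span B" and V: "finite (carrier V)"
    and K: "finite (carrier K)"
    and M: "\<And>p. p \<in> T \<Longrightarrow> card {p'\<in>T. same_class B p p'} \<le> M"
  shows "card T * ((card (carrier K) - 1) * card (span B)) \<le> M * card (carrier V)"
proof -
  have fT: "finite T" using T V finite_subset by blast
  have sub: "{v. same_class B p v} \<subseteq> carrier V" if "p \<in> T" for p
    using that T B by (auto simp: same_class_def)
  have "card T * ((card (carrier K) - 1) * card (span B))
      = (\<Sum>p\<in>T. card {v\<in>carrier V. same_class B p v})"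
  proof -
    have "{v\<in>carrier V. same_class B p v} = {v. same_class B p v}" if "p \<in> T" for p
      using sub[OF that] by auto
    then show ?thesis using card_class[OF B _ _ K] T by (simp add: subset_iff)
  qed
  also have "\<dots> = (\<Sum>v\<in>carrier V. card {p\<in>T. same_class B p v})"
    by (rule sum_multicount_gen) (use fT V in auto)
  also have "\<dots> \<le> (\<Sum>v\<in>carrier V. M)"
  proof (rule sum_mono)
    fix v assume "v \<in> carrier V"
    show "card {p\<in>T. same_class B p v} \<le> M"
    \<comment> \<open>If some \<open>p\<close> reaches \<open>v\<close>, all points that reach
      \<open>v\<close> lie in the class of this \<open>p\<close>, so \<open>M\<close> bounds their
      number.\<close>
    proof (cases "{p\<in>T. same_class B p v} = {}")
      case True
      show ?thesis unfolding True by simp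
    next
      case False
      then obtain p where p: "p \<in> T" "same_class B p v" by auto
      have "{p\<in>T. same_class B p v} \<subseteq> {p'\<in>T. same_class B p p'}"
        using same_class_trans_sym[OF B] p T by auto
      then have "card {p\<in>T. same_class B p v} \<le> card {p'\<in>T. same_class B p p'}"
        using fT by (intro card_mono) auto
      then show ?thesis using M[OF p(1)] by simp
    qed
  qed
  also have "\<dots> = M * card (carrier V)" by simp
  finally show ?thesis .
qed

end

subsection \<open>Enlarging circuits in large sets\<close>

context vectorspace
begin

text \<open>These are sets of projective points with one representing vector each. The value
  \<open>l = 0\<close> does no harm, because zero is excluded from \<open>S\<close>.\<close>

definition pairwise_nonparallel :: "'c set \<Rightarrow> bool" where
  "pairwise_nonparallel S \<longleftrightarrow> S \<subseteq> carrier V - {\<zero>\<^bsub>V\<^esub>} \<and>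
    (\<forall>x\<in>S. \<forall>y\<in>S. \<forall>l\<in>carrier K. y = l \<odot>\<^bsub>V\<^esub> x \<longrightarrow> y = x)"

lemma pairwise_nonparallelD:
  assumes "pairwise_nonparallel S"
  shows "S \<subseteq> carrier V" "\<zero>\<^bsub>V\<^esub> \<notin> S"
    and "x \<in> S \<Longrightarrow> y \<in> S \<Longrightarrow> l \<in> carrier K \<Longrightarrow> y = l \<odot>\<^bsub>V\<^esub> x \<Longrightarrow> y = x"
  using assms by (auto simp: pairwise_nonparallel_def)

text \<open>As \<open>x\<close> is nonzero, \<open>u\<close> is a multiple of \<open>x\<close>, and
  therefore so is \<open>y\<close>.\<close>

lemma pairwise_nonparallel_common_line:
  assumes S: "pairwise_nonparallel S" "x \<in> S" "y \<in> S" and u: "u \<in> carrier V"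
    and l: "l \<in> carrier K" "x = l \<odot>\<^bsub>V\<^esub> u" and m: "m \<in> carrier K" "y = m \<odot>\<^bsub>V\<^esub> u"
  shows "x = y"
proof -
  have l0: "l \<noteq> \<zero>\<^bsub>K\<^esub>" using pairwise_nonparallelD(2)[OF S(1)] S(2) l u by auto
  then have i: "inv\<^bsub>K\<^esub> l \<in> carrier K" using l field_Units by auto
  have "u = inv\<^bsub>K\<^esub> l \<odot>\<^bsub>V\<^esub> x" using mult_inverse[OF l(1) u l(2)[symmetric] l0] .
  then have "y = (m \<otimes>\<^bsub>K\<^esub> inv\<^bsub>K\<^esub> l) \<odot>\<^bsub>V\<^esub> x"
    using m i l u by (metis smult_assoc1 smult_closed)
  then show ?thesis
    using pairwise_nonparallelD(3)[OF S, of "m \<otimes>\<^bsub>K\<^esub> inv\<^bsub>K\<^esub> l"] m i by auto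
qed

text \<open>A smaller circuit would be the empty set, the zero vector alone, or a pair of parallel
  vectors.\<close>

lemma circuit_card_ge_3:
  assumes S: "pairwise_nonparallel S" and C: "circuit C" "C \<subseteq> S"
  shows "3 \<le> card C"
proof (rule ccontr)
  assume "\<not> 3 \<le> card C"
  then consider "card C = 0" | "card C = 1" | "card C = 2" by linarith
  moreover note Cf = circuitD[OF C(1)]
  obtain a where a: "a \<in> C \<rightarrow> carrier K" "lincomb a C = \<zero>\<^bsub>V\<^esub>" "\<And>x. x \<in> C \<Longrightarrow> a x \<noteq> \<zero>\<^bsub>K\<^esub>"
    using circuit_relation[OF C(1)] by blast
  ultimately show False
  proof cases
    case 1
    then have "C = {}" using Cf by auto
    then show False using Cf by (auto simp: lin_dep_def)
  next
    case 2
    then obtain x where x: "C = {x}" by (auto simp: card_1_singleton_iff)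
    have "x \<in> span (C - {x})"
      by (rule lincomb_isolate(2)[where a = a]) (use a Cf x in auto)
    then have "x = \<zero>\<^bsub>V\<^esub>" using x by (simp add: span_empty)
    then show False using pairwise_nonparallelD(2)[OF S] C x by auto
  next
    case 3
    then obtain x y where x: "C = {x, y}" "x \<noteq> y" by (auto simp: card_2_iff)
    have "y \<in> span (C - {y})"
      by (rule lincomb_isolate(2)[where a = a]) (use a Cf x in auto)
    moreover have "C - {y} = {x}" using x by auto
    ultimately obtain b where b: "b \<in> {x} \<rightarrow> carrier K" "lincomb b {x} = y"
      using finite_in_span[of "{x}" y] Cf x by auto
    then have "y = b x \<odot>\<^bsub>V\<^esub> x"
      using Cf x lincomb_insert2[of "{}" b x] by (auto simp: lincomb_empty)
    then show False using pairwise_nonparallelD(3)[OF S, of x y "b x"] C x b by auto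
  qed
qed

lemma lin_dep_contains_circuit:
  assumes "finite A" "A \<subseteq> carrier V" "lin_dep A"
  obtains C where "C \<subseteq> A" "circuit C"
proof -
  obtain C where C: "C \<subseteq> A" "minimal C lin_dep" using minimal_exists[of A lin_dep] assms by auto
  have "lin_indpt (C - {x})" if "x \<in> C" for x
    using C(2) that unfolding minimal_def by blast
  then have "circuit C"
    using C assms finite_subset unfolding circuit_def minimal_def by blast
  with C that show thesis by blast
qed

text \<open>The nonzero multiples of points of \<open>S\<close> in the span again lie in the span
  and are pairwise distinct.\<close>

lemma card_nonparallel_in_span:
  assumes S: "pairwise_nonparallel S" and B: "B \<subseteq> carrier V" and fin: "finite (carrier V)"
    and K: "finite (carrier K)"
  shows "(card (carrier K) - 1) * card (S \<inter> span B) \<le> card (span B)"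
proof -
  let ?f = "\<lambda>(l, s). l \<odot>\<^bsub>V\<^esub> s" and ?D = "(carrier K - {\<zero>\<^bsub>K\<^esub>}) \<times> (S \<inter> span B)"
  note Sc = pairwise_nonparallelD[OF S]
  have "inj_on ?f ?D"
  proof (rule inj_onI)
    fix x y assume xy: "x \<in> ?D" "y \<in> ?D" "?f x = ?f y"
    obtain l s m t where x: "x = (l, s)" and y: "y = (m, t)" by (metis surj_pair)
    have l: "l \<in> carrier K" "l \<noteq> \<zero>\<^bsub>K\<^esub>" "s \<in> S" and m: "m \<in> carrier K" "m \<noteq> \<zero>\<^bsub>K\<^esub>" "t \<in> S"
      and eq: "l \<odot>\<^bsub>V\<^esub> s = m \<odot>\<^bsub>V\<^esub> t"
      using xy x y by auto
    have c: "s \<in> carrier V" "t \<in> carrier V" using Sc l m by auto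
    have i: "inv\<^bsub>K\<^esub> l \<in> carrier K" using l field_Units by auto
    have "s = inv\<^bsub>K\<^esub> l \<odot>\<^bsub>V\<^esub> (m \<odot>\<^bsub>V\<^esub> t)" using mult_inverse[OF l(1) c(1) eq l(2)] .
    then have "s = (inv\<^bsub>K\<^esub> l \<otimes>\<^bsub>K\<^esub> m) \<odot>\<^bsub>V\<^esub> t" using i m c by (simp add: smult_assoc1)
    then have st: "s = t" using Sc(3)[of t s "inv\<^bsub>K\<^esub> l \<otimes>\<^bsub>K\<^esub> m"] l m i by auto
    have t0: "t \<noteq> \<zero>\<^bsub>V\<^esub>" using Sc(2) m by auto
    have "(l \<ominus>\<^bsub>K\<^esub> m) \<odot>\<^bsub>V\<^esub> t = \<zero>\<^bsub>V\<^esub>"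
      using eq st l m c by (simp add: R.minus_eq smult_l_distr smult_l_minus M.r_neg)
    then have "l \<ominus>\<^bsub>K\<^esub> m = \<zero>\<^bsub>K\<^esub>"
      using span_smult_cancel[of "{}" t "l \<ominus>\<^bsub>K\<^esub> m"] t0 l m c by (auto simp: span_empty)
    then show "x = y" using st l m x y by auto
  qed
  moreover have "?f ` ?D \<subseteq> span B" using submodule.smult_closed[OF span_is_submodule[OF B]] by auto
  moreover have "finite (span B)" using span_is_subset2[OF B] fin finite_subset by blast
  ultimately have "card ?D \<le> card (span B)" by (metis card_inj_on_le)
  then show ?thesis using K by (simp add: card_cartesian_product card_Diff_singleton)
qed

text \<open>Each \<open>p'\<close> in the class of \<open>p\<close> is a multiple of some
  \<open>pt c\<close> with \<open>c\<close> normalised by \<open>c x0 = 0\<close>. If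
  \<open>c\<close> took some value exactly once, \<open>circuit_exchange\<close> would yield a
  forbidden circuit, so \<open>c\<close> lies in \<open>bad\<close>. Since \<open>S\<close> has no
  parallel vectors, \<open>c\<close> determines \<open>p'\<close>, and \<open>card bad\<close>
  bounds the class.\<close>

lemma card_class_le:
  assumes S: "pairwise_nonparallel S" and C: "circuit C" "C \<subseteq> S"
    and no: "\<And>E. E \<subseteq> S \<Longrightarrow> circuit E \<Longrightarrow> card E \<noteq> card C + 1"
    and p: "p \<in> S - span C" and K: "finite (carrier K)" and fin: "finite (carrier V)"
  shows "card {p' \<in> S - span C. same_class C p p'}
    \<le> (card C)\<^sup>2 * card (carrier K) ^ (card C - 3)"
proof -
  note Sc = pairwise_nonparallelD[OF S] and Cf = circuitD(1,2)[OF C(1)]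
  note C3 = circuit_card_ge_3[OF S C]
  then obtain x0 where x0: "x0 \<in> C" by (metis card.empty ex_in_conv not_numeral_le_zero)
  obtain a where a: "a \<in> C \<rightarrow> carrier K" "lincomb a C = \<zero>\<^bsub>V\<^esub>" "\<And>x. x \<in> C \<Longrightarrow> a x \<noteq> \<zero>\<^bsub>K\<^esub>"
    using circuit_relation[OF C(1)] by blast
  define bad where "bad = {c \<in> C \<rightarrow>\<^sub>E carrier K. c x0 = \<zero>\<^bsub>K\<^esub> \<and> (\<forall>x\<in>C. \<exists>y\<in>C - {x}. c y = c x)}"
  define pt where "pt = (\<lambda>c. p \<oplus>\<^bsub>V\<^esub> lincomb (\<lambda>x. c x \<otimes>\<^bsub>K\<^esub> a x) C)"
  have pc: "p \<in> carrier V" using p Sc by auto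
  have finbad: "finite bad"
    using finite_PiE[of C "\<lambda>_. carrier K"] Cf K unfolding bad_def by auto
  \<comment> \<open>Subtracting a multiple of the circuit relation leaves the vector unchanged; this
    is the freedom of an additive constant in \<open>c\<close>.\<close>
  have shift: "lincomb (\<lambda>x. e x \<ominus>\<^bsub>K\<^esub> t \<otimes>\<^bsub>K\<^esub> a x) C = lincomb e C"
    if "e \<in> C \<rightarrow> carrier K" "t \<in> carrier K" for e t
  proof -
    have "lincomb (\<lambda>x. e x \<ominus>\<^bsub>K\<^esub> t \<otimes>\<^bsub>K\<^esub> a x) C = lincomb e C \<ominus>\<^bsub>V\<^esub> lincomb (\<lambda>x. t \<otimes>\<^bsub>K\<^esub> a x) C"
      by (rule lincomb_diff) (use that a Cf in auto)
    then show ?thesis using lincomb_smult[of C a t] that a Cf by (simp add: M.minus_eq)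
  qed
  have "\<exists>c\<in>bad. \<exists>l\<in>carrier K. p' = l \<odot>\<^bsub>V\<^esub> pt c"
    if p': "p' \<in> S - span C" "same_class C p p'" for p'
  \<comment> \<open>The point \<open>p\<close> itself is treated apart, since
    \<open>circuit_exchange\<close> requires two different points. It corresponds to the zero
    function, which has no unique value because \<open>C\<close> has more than one element.\<close>
  proof (cases "p' = p")
    case True
    let ?c = "\<lambda>x\<in>C. \<zero>\<^bsub>K\<^esub>"
    have "\<exists>y\<in>C - {x}. ?c y = ?c x" if "x \<in> C" for x
    proof -
      have "card (C - {x}) \<noteq> 0" using C3 Cf that by simp
      then obtain y where "y \<in> C - {x}" by (metis card.empty ex_in_conv)
      then show ?thesis using that by auto
    qed
    then have "?c \<in> bad" using x0 by (auto simp: bad_def)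
    moreover have "lincomb (\<lambda>x. ?c x \<otimes>\<^bsub>K\<^esub> a x) C = \<zero>\<^bsub>V\<^esub>"
      by (rule lincomb_zero) (use Cf funcset_mem[OF a(1)] in auto)
    then have "p' = \<one>\<^bsub>K\<^esub> \<odot>\<^bsub>V\<^esub> pt ?c" using True pc by (simp add: pt_def)
    ultimately show ?thesis by blast
  next
    case False
    obtain l w where l: "l \<in> carrier K" "l \<noteq> \<zero>\<^bsub>K\<^esub>" "w \<in> span C" "p' = l \<odot>\<^bsub>V\<^esub> p \<oplus>\<^bsub>V\<^esub> w"
      using p' by (auto simp: same_class_def)
    have il: "inv\<^bsub>K\<^esub> l \<in> carrier K" "l \<otimes>\<^bsub>K\<^esub> inv\<^bsub>K\<^esub> l = \<one>\<^bsub>K\<^esub>" using l field_Units by auto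
    have lw: "l \<odot>\<^bsub>V\<^esub> (inv\<^bsub>K\<^esub> l \<odot>\<^bsub>V\<^esub> w) = w"
      using l(1) il span_closed[OF Cf(2) l(3)] by (simp flip: smult_assoc1)
    have "inv\<^bsub>K\<^esub> l \<odot>\<^bsub>V\<^esub> w \<in> span C"
      using submodule.smult_closed[OF span_is_submodule[OF Cf(2)]] l il by metis
    then obtain e where e: "e \<in> C \<rightarrow> carrier K" "lincomb e C = inv\<^bsub>K\<^esub> l \<odot>\<^bsub>V\<^esub> w"
      using finite_in_span[OF Cf] by metis
    \<comment> \<open>Coefficients are measured in units of the circuit relation, so that
      \<open>shift\<close> turns into adding a constant to \<open>c0\<close>. Below,
      \<open>c\<close> is the representative that vanishes at \<open>x0\<close>.\<close>
    define c0 where "c0 = (\<lambda>x. e x \<otimes>\<^bsub>K\<^esub> inv\<^bsub>K\<^esub> (a x))"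
    have aU: "a x \<in> Units K" if "x \<in> C" for x using a that field_Units by (auto simp: Pi_iff)
    have ac: "a x \<in> carrier K" "e x \<in> carrier K" if "x \<in> C" for x using a e that by auto
    have c0: "c0 x \<in> carrier K" "c0 x \<otimes>\<^bsub>K\<^esub> a x = e x" if "x \<in> C" for x
      using aU[OF that] ac[OF that] by (auto simp: c0_def R.m_assoc)
    define c where "c = (\<lambda>x\<in>C. c0 x \<ominus>\<^bsub>K\<^esub> c0 x0)"
    have ca: "c x \<otimes>\<^bsub>K\<^esub> a x = e x \<ominus>\<^bsub>K\<^esub> c0 x0 \<otimes>\<^bsub>K\<^esub> a x" if "x \<in> C" for x
    proof -
      have "c x \<otimes>\<^bsub>K\<^esub> a x = c0 x \<otimes>\<^bsub>K\<^esub> a x \<ominus>\<^bsub>K\<^esub> c0 x0 \<otimes>\<^bsub>K\<^esub> a x"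
        using c0(1)[OF that] c0(1)[OF x0] ac[OF that] that
        by (simp add: c_def R.minus_eq R.l_distr R.l_minus)
      then show ?thesis using c0(2)[OF that] by simp
    qed
    have "lincomb (\<lambda>x. c x \<otimes>\<^bsub>K\<^esub> a x) C = lincomb (\<lambda>x. e x \<ominus>\<^bsub>K\<^esub> c0 x0 \<otimes>\<^bsub>K\<^esub> a x) C"
      by (rule lincomb_cong) (use ca Cf c0(1)[OF x0] ac in auto)
    also have "\<dots> = inv\<^bsub>K\<^esub> l \<odot>\<^bsub>V\<^esub> w" using shift[OF e(1) c0(1)[OF x0]] e(2) by simp
    finally have "p' = l \<odot>\<^bsub>V\<^esub> pt c"
      using l il(1) lw pc span_closed[OF Cf(2) l(3)] by (simp add: pt_def smult_r_distr)
    moreover have "c \<in> bad"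
    proof -
      have "\<exists>y\<in>C - {x}. c y = c x" if x: "x \<in> C" for x
      proof (rule ccontr)
        assume neg: "\<not> ?thesis"
        have c0ne: "c0 y \<noteq> c0 x" if "y \<in> C - {x}" for y
        proof
          assume "c0 y = c0 x"
          then have "c y = c x" using that x by (simp add: c_def)
          then show False using neg that by blast
        qed
        \<comment> \<open>If the value at \<open>x\<close> occurs nowhere else, shifting
          \<open>c0\<close> by \<open>c0 x\<close> gives coefficients of \<open>w\<close> that
          vanish at \<open>x\<close> only. The factor \<open>l\<close> undoes the earlier division
          of \<open>w\<close> by \<open>l\<close>.\<close>
        define g where "g = (\<lambda>y. l \<otimes>\<^bsub>K\<^esub> (e y \<ominus>\<^bsub>K\<^esub> c0 x \<otimes>\<^bsub>K\<^esub> a y))"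
        have hc: "(\<lambda>y. e y \<ominus>\<^bsub>K\<^esub> c0 x \<otimes>\<^bsub>K\<^esub> a y) \<in> C \<rightarrow> carrier K" using ac c0(1)[OF x] by auto
        have "lincomb g C = l \<odot>\<^bsub>V\<^esub> (inv\<^bsub>K\<^esub> l \<odot>\<^bsub>V\<^esub> w)"
          unfolding g_def using lincomb_smult[OF Cf(2) hc l(1)] shift[OF e(1) c0(1)[OF x]] e(2) by simp
        also note lw
        finally have gw: "lincomb g C = w" .
        have eg: "e y \<ominus>\<^bsub>K\<^esub> c0 x \<otimes>\<^bsub>K\<^esub> a y = (c0 y \<ominus>\<^bsub>K\<^esub> c0 x) \<otimes>\<^bsub>K\<^esub> a y" if "y \<in> C" for y
          unfolding c0(2)[OF that, symmetric]
          using c0(1)[OF that] c0(1)[OF x] ac[OF that] by (simp add: R.minus_eq R.l_distr R.l_minus)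
        have "circuit (insert p (insert p' (C - {x})))"
        proof (rule circuit_exchange[OF C(1) pc _ _ _ l(1,2) _ _ x])
          show "g \<in> C \<rightarrow> carrier K" using hc l(1) by (auto simp: g_def)
          show "p' = l \<odot>\<^bsub>V\<^esub> p \<oplus>\<^bsub>V\<^esub> lincomb g C" using gw l(4) by simp
          show "g x = \<zero>\<^bsub>K\<^esub>"
            using eg[OF x] c0(1)[OF x] ac[OF x] l(1) by (simp add: g_def R.minus_eq R.r_neg)
          fix y assume y: "y \<in> C - {x}"
          have yC: "y \<in> C" using y by auto
          have "c0 y \<ominus>\<^bsub>K\<^esub> c0 x \<noteq> \<zero>\<^bsub>K\<^esub>" using c0ne[OF y] c0(1)[OF x] c0(1)[OF yC] by simp
          then show "g y \<noteq> \<zero>\<^bsub>K\<^esub>"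
            using eg[OF yC] c0(1)[OF x] c0(1)[OF yC] ac[OF yC] l a(3)[OF yC] integral_iff
            by (simp add: g_def)
        qed (use p p' False in auto)
        moreover have "insert p (insert p' (C - {x})) \<subseteq> S" using C p p' by auto
        moreover have "card (insert p (insert p' (C - {x}))) = card C + 1"
        proof -
          have "p \<notin> C" "p' \<notin> C" using span_mem[OF Cf(2)] p p' by auto
          then show ?thesis using False x Cf C3 by simp
        qed
        ultimately show False using no by blast
      qed
      moreover have "c x0 = \<zero>\<^bsub>K\<^esub>" using c0(1)[OF x0] x0 by (simp add: c_def R.minus_eq R.r_neg)
      moreover have "c \<in> C \<rightarrow>\<^sub>E carrier K" using c0(1) x0 by (auto simp: c_def)
      ultimately show ?thesis by (simp add: bad_def)
    qed
    ultimately show ?thesis using l(1) by blast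
  qed
  then obtain cc where cc: "\<And>p'. p' \<in> S - span C \<Longrightarrow> same_class C p p' \<Longrightarrow>
      cc p' \<in> bad \<and> (\<exists>l\<in>carrier K. p' = l \<odot>\<^bsub>V\<^esub> pt (cc p'))"
    by metis
  \<comment> \<open>Points with the same function are multiples of one vector
    \<open>pt (cc s)\<close>, hence equal.\<close>
  have "inj_on cc {p' \<in> S - span C. same_class C p p'}"
  proof (rule inj_onI)
    fix s t
    assume s: "s \<in> {p' \<in> S - span C. same_class C p p'}" and t: "t \<in> {p' \<in> S - span C. same_class C p p'}"
      and st: "cc s = cc t"
    obtain l where l: "l \<in> carrier K" "s = l \<odot>\<^bsub>V\<^esub> pt (cc s)" using cc[of s] s by auto
    obtain m where m: "m \<in> carrier K" "t = m \<odot>\<^bsub>V\<^esub> pt (cc s)" using cc[of t] t st by auto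
    have "cc s \<in> bad" using cc[of s] s by auto
    then have "(\<lambda>x. cc s x \<otimes>\<^bsub>K\<^esub> a x) \<in> C \<rightarrow> carrier K" using a by (auto simp: bad_def)
    then have "pt (cc s) \<in> carrier V" using pc Cf by (simp add: pt_def)
    then show "s = t"
      using pairwise_nonparallel_common_line[OF S _ _ _ l m] s t by auto
  qed
  moreover have "cc ` {p' \<in> S - span C. same_class C p p'} \<subseteq> bad" using cc by auto
  ultimately have "card {p' \<in> S - span C. same_class C p p'} \<le> card bad"
    using finbad by (metis card_inj_on_le)
  also have "\<dots> \<le> (card C)\<^sup>2 * card (carrier K) ^ (card C - 3)"
    unfolding bad_def by (rule card_functions_without_unique_value) (use K Cf C3 x0 in auto)
  finally show ?thesis .
qed

section \<open>Size bounds and the climb to circuits of size \<open>r\<close>\<close>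

text \<open>The points in \<open>span C\<close> are counted by
  \<open>card_nonparallel_in_span\<close>, those off it by \<open>card_le_of_class_bound\<close>
  with the class bound of \<open>card_class_le\<close>.\<close>

lemma card_le_without_larger_circuit:
  assumes S: "pairwise_nonparallel S" and C: "circuit C" "C \<subseteq> S" "card C < r" and r: "4 \<le> r"
    and no: "\<And>E. E \<subseteq> S \<Longrightarrow> circuit E \<Longrightarrow> card E \<noteq> card C + 1"
    and q: "card (carrier K) = q" "2 \<le> q" and V: "card (carrier V) = q ^ r"
  shows "card S \<le> (2 + 2 * r\<^sup>2) * q ^ (r - 3)"
proof -
  note Cf = circuitD(1,2)[OF C(1)]
  have K: "finite (carrier K)" using q card_ge_0_finite by force
  have fin: "finite (carrier V)" using V q card_ge_0_finite[of "carrier V"] by force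
  define k where "k = card C"
  have k: "3 \<le> k" "k < r" using circuit_card_ge_3[OF S C(1,2)] C(3) by (auto simp: k_def)
  have Cne: "C \<noteq> {}" using k by (auto simp: k_def)
  have W: "card (span C) = q ^ (k - 1)" using card_span_circuit[OF C(1) K Cne] q by (simp add: k_def)
  have fS: "finite S" using pairwise_nonparallelD(1)[OF S] fin finite_subset by blast
  define X where "X = card (S \<inter> span C)"
  define Y where "Y = card (S - span C)"
  \<comment> \<open>This replaces \<open>q - 1\<close> by \<open>q\<close> at the price of the
    factor 2 in both bounds.\<close>
  have q1: "q \<le> 2 * (q - 1)" using q by auto
  have X: "X \<le> 2 * q ^ (r - 3)"
  proof -
    have "q * X \<le> 2 * ((q - 1) * X)" using q1 by (metis mult.assoc mult_le_mono1)
    also have "\<dots> \<le> 2 * q ^ (k - 1)"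
      using card_nonparallel_in_span[OF S Cf(2) fin K] W q by (simp add: X_def)
    also have "\<dots> = q * (2 * q ^ (k - 2))"
    proof -
      have "k - 1 = Suc (k - 2)" using k by simp
      then show ?thesis by simp
    qed
    finally have "X \<le> 2 * q ^ (k - 2)" using q by simp
    \<comment> \<open>From \<open>k < r\<close> it follows that \<open>k - 2\<close> is at most
      \<open>r - 3\<close>.\<close>
    also have "\<dots> \<le> 2 * q ^ (r - 3)" using q k by (simp add: power_increasing)
    finally show ?thesis .
  qed
  have Y: "Y \<le> 2 * r\<^sup>2 * q ^ (r - 3)"
  proof -
    have "Y * ((card (carrier K) - 1) * card (span C))
        \<le> ((card C)\<^sup>2 * card (carrier K) ^ (card C - 3)) * card (carrier V)"
      unfolding Y_def
    proof (rule card_le_of_class_bound[OF Cf(2) _ fin K])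
      show "S - span C \<subseteq> carrier V - span C" using pairwise_nonparallelD(1)[OF S] by auto
    next
      fix p assume p: "p \<in> S - span C"
      show "card {p' \<in> S - span C. same_class C p p'} \<le> (card C)\<^sup>2 * card (carrier K) ^ (card C - 3)"
        using card_class_le[OF S C(1,2) _ p K fin] no by blast
    qed
    then have "Y * ((q - 1) * q ^ (k - 1)) \<le> (k\<^sup>2 * q ^ (k - 3)) * q ^ r"
      unfolding W q(1) V k_def[symmetric] .
    moreover have "q * (Y * q ^ (k - 1)) \<le> 2 * (Y * ((q - 1) * q ^ (k - 1)))"
      using mult_le_mono1[OF q1, of "Y * q ^ (k - 1)"] by (simp add: mult_ac)
    ultimately have "q * (Y * q ^ (k - 1)) \<le> 2 * ((k\<^sup>2 * q ^ (k - 3)) * q ^ r)" by linarith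
    also have "\<dots> = 2 * k\<^sup>2 * q ^ (r + (k - 3))" by (simp add: power_add)
    also have "\<dots> = q * ((2 * k\<^sup>2 * q ^ (r - 3)) * q ^ (k - 1))"
    proof -
      \<comment> \<open>Both \<open>k\<close> and \<open>r\<close> are at least 3, so no subtraction
        is truncated.\<close>
      have "r + (k - 3) = Suc ((r - 3) + (k - 1))" using k by simp
      then show ?thesis by (simp add: power_add)
    qed
    finally have "Y \<le> 2 * k\<^sup>2 * q ^ (r - 3)" using q by simp
    also have "\<dots> \<le> 2 * r\<^sup>2 * q ^ (r - 3)" using k by (simp add: power_mono)
    finally show ?thesis .
  qed
  have "card S = X + Y"
    unfolding X_def Y_def using fS by (metis card_Int_Diff)
  then show ?thesis using X Y by (simp add: algebra_simps)
qed

text \<open>Here any \<open>r\<close> points of \<open>S\<close> are independent. Modulo the span of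
  \<open>r - 2\<close> of them, two further points in one class would make \<open>r\<close>
  dependent points, so the class bound holds with \<open>M = 1\<close>.\<close>

lemma card_le_without_small_circuit:
  assumes S: "S \<subseteq> carrier V" and r: "4 \<le> r"
    and no: "\<And>E. E \<subseteq> S \<Longrightarrow> circuit E \<Longrightarrow> r < card E"
    and q: "card (carrier K) = q" "2 \<le> q" and V: "card (carrier V) = q ^ r"
  shows "card S \<le> (r + 2) * q ^ (r - 3)"
proof -
  have K: "finite (carrier K)" using q card_ge_0_finite by force
  have fin: "finite (carrier V)" using V q card_ge_0_finite[of "carrier V"] by force
  have fS: "finite S" using S fin finite_subset by blast
  have indep: "lin_indpt A" if A: "A \<subseteq> S" "card A \<le> r" for A
  proof (rule ccontr)
    have fA: "finite A" using A fS finite_subset by blast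
    assume "\<not> lin_indpt A"
    then have "lin_dep A" by blast
    then obtain C where C: "C \<subseteq> A" "circuit C"
      by (rule lin_dep_contains_circuit[OF fA subset_trans[OF A(1) S]])
    then have "C \<subseteq> S" using A(1) by blast
    then have "r < card C" using no C(2) by blast
    then show False using card_mono[OF fA C(1)] A(2) by linarith
  qed
  \<comment> \<open>With \<open>r\<close> at least 4 the exponent \<open>r - 3\<close> is positive,
    so the linear term \<open>2 * q\<close> found below is absorbed.\<close>
  have qq: "q ^ 1 \<le> q ^ (r - 3)" using q r by (intro power_increasing) auto
  then have q1: "q \<le> q ^ (r - 3)" by simp
  have q0: "1 \<le> q ^ (r - 3)" using q by simp
  show ?thesis
  proof (cases "card S \<le> r")
    case True
    have "r * 1 \<le> (r + 2) * q ^ (r - 3)" by (rule mult_le_mono[OF _ q0]) simp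
    then show ?thesis using True by linarith
  next
    case False
    then have "r - 2 \<le> card S" by simp
    then obtain A where A: "A \<subseteq> S" "card A = r - 2" "finite A"
      by (rule obtain_subset_with_card_n)
    have Ac: "A \<subseteq> carrier V" and Ai: "lin_indpt A" using A S indep by auto
    \<comment> \<open>With \<open>B\<close> empty this puts \<open>S - A\<close> off
      \<open>span A\<close>; with \<open>B\<close> a singleton it separates the classes. In both
      cases at most \<open>r\<close> points are involved.\<close>
    have notspan: "p \<notin> span (A \<union> B)" if "p \<in> S - (A \<union> B)" "B \<subseteq> S" "card B \<le> 1" for p B
    proof
      assume p: "p \<in> span (A \<union> B)"
      have "card (A \<union> B) \<le> r - 1" using card_Un_le[of A B] that A r by linarith
      moreover have "finite (A \<union> B)" using A that fS finite_subset by blast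
      ultimately have "card (A \<union> B \<union> {p}) \<le> r" using that r by simp
      moreover have "A \<union> B \<union> {p} \<subseteq> S" using A that by blast
      ultimately have i: "lin_indpt (A \<union> B \<union> {p})" by (intro indep)
      then have "lin_indpt (A \<union> B)" by (rule subset_li_is_li) blast
      moreover have "A \<union> B \<subseteq> carrier V" "p \<in> carrier V" "p \<notin> A \<union> B" using A that S by blast+
      ultimately show False using lin_dep_iff_in_span p i by blast
    qed
    have "card (S - A) * ((q - 1) * q ^ (r - 2)) \<le> 1 * q ^ r"
    proof -
      have "card (span A) = q ^ (r - 2)" using card_span_lin_indpt[OF A(3) Ac Ai K] A q by simp
      moreover have "card (S - A) * ((card (carrier K) - 1) * card (span A)) \<le> 1 * card (carrier V)"
      proof (rule card_le_of_class_bound[OF Ac _ fin K])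
        show "S - A \<subseteq> carrier V - span A" using notspan[of _ "{}"] S by auto
        fix p assume p: "p \<in> S - A"
        have "p' = p" if p': "p' \<in> S - A" "same_class A p p'" for p'
        proof (rule ccontr)
          assume "p' \<noteq> p"
          then have n: "p' \<notin> span (A \<union> {p})" using notspan[of p' "{p}"] p p' by auto
          obtain l w where lw: "l \<in> carrier K" "w \<in> span A" "p' = l \<odot>\<^bsub>V\<^esub> p \<oplus>\<^bsub>V\<^esub> w"
            using p' by (auto simp: same_class_def)
          have Apc: "A \<union> {p} \<subseteq> carrier V" using Ac p S by blast
          have "w \<in> span (A \<union> {p})" using lw(2) span_is_monotone[of A "A \<union> {p}"] by blast
          moreover have "p \<in> span (A \<union> {p})" using span_mem[OF Apc] by blast
          ultimately have "p' \<in> span (A \<union> {p})"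
            unfolding lw(3) using lw(1) by (intro span_add_smult[OF Apc])
          then show False using n by simp
        qed
        then have "{p' \<in> S - A. same_class A p p'} \<subseteq> {p}" by auto
        then show "card {p' \<in> S - A. same_class A p p'} \<le> 1"
          using card_mono[of "{p}" "{p' \<in> S - A. same_class A p p'}"] by simp
      qed
      ultimately show ?thesis using q V by simp
    qed
    also have "1 * q ^ r = (q * q) * q ^ (r - 2)"
    proof -
      have "r = Suc (Suc (r - 2))" using r by simp
      then have "q ^ r = q ^ Suc (Suc (r - 2))" by simp
      then show ?thesis by simp
    qed
    finally have "(card (S - A) * (q - 1)) * q ^ (r - 2) \<le> (q * q) * q ^ (r - 2)"
      by (simp only: mult.assoc)
    then have *: "card (S - A) * (q - 1) \<le> q * q" using q by (simp only: mult_le_cancel2) simp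
    have "card (S - A) * q \<le> card (S - A) * (2 * (q - 1))" using q by (intro mult_le_mono2) simp
    also have "\<dots> = 2 * (card (S - A) * (q - 1))" by simp
    also have "\<dots> \<le> 2 * (q * q)" using * by (rule mult_le_mono2)
    finally have "card (S - A) * q \<le> (2 * q) * q" by (simp only: mult.assoc)
    then have "card (S - A) \<le> 2 * q" using q by simp
    moreover have "card S = card (S - A) + (r - 2)"
      using card_Diff_subset[OF A(3,1)] card_mono[OF fS A(1)] A(2) by simp
    moreover have "r * 1 \<le> r * q ^ (r - 3)" using q0 by (rule mult_le_mono2)
    ultimately have "card S \<le> r * q ^ (r - 3) + 2 * q ^ (r - 3)" using q1 by linarith
    then show ?thesis by (simp only: distrib_right)
  qed
qed

text \<open>A circuit of size at most \<open>r\<close> exists by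
  \<open>card_le_without_small_circuit\<close>, and \<open>card_le_without_larger_circuit\<close>
  raises its size one step at a time up to \<open>r\<close>.\<close>

theorem exists_circuit_of_card:
  assumes S: "pairwise_nonparallel S" and r: "4 \<le> r"
    and q: "card (carrier K) = q" "2 \<le> q" and V: "card (carrier V) = q ^ r"
    and large: "(5 + r + 2 * r\<^sup>2) * q ^ (r - 3) \<le> card S"
  shows "\<exists>C\<subseteq>S. circuit C \<and> card C = r"
proof -
  \<comment> \<open>The constant in \<open>large\<close> strictly exceeds the constants
    \<open>2 + 2 * r\<^sup>2\<close> and \<open>r + 2\<close> of the two size bounds, so each of
    them is contradicted.\<close>
  have lt: "m * q ^ (r - 3) < card S" if "m < 5 + r + 2 * r\<^sup>2" for m
  proof -
    have "m * q ^ (r - 3) < (5 + r + 2 * r\<^sup>2) * q ^ (r - 3)" using that q by simp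
    then show ?thesis using large by linarith
  qed
  have "\<exists>C\<subseteq>S. circuit C \<and> card C = n" if "k \<le> n" "n \<le> r" "\<exists>C\<subseteq>S. circuit C \<and> card C = k" for n k
    using that
  proof (induction n rule: dec_induct)
    case (step n)
    then obtain C where C: "C \<subseteq> S" "circuit C" "card C = n" by auto
    have "\<not> card S \<le> (2 + 2 * r\<^sup>2) * q ^ (r - 3)" using lt[of "2 + 2 * r\<^sup>2"] by simp
    then show ?case
      using card_le_without_larger_circuit[OF S C(2,1) _ r _ q V] C(3) step.prems by auto
  qed auto
  moreover have "\<exists>C\<subseteq>S. circuit C \<and> card C \<le> r"
  proof (rule ccontr)
    assume "\<not> ?thesis"
    then have "card S \<le> (r + 2) * q ^ (r - 3)"
      by (intro card_le_without_small_circuit pairwise_nonparallelD(1)[OF S] r q V) (auto simp: not_le)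
    then show False using lt[of "r + 2"] by simp
  qed
  ultimately show ?thesis by blast
qed

end

subsection \<open>Homogeneous coordinates\<close>

text \<open>Two vector spaces are in play at once: \<open>V\<close> contains the points,
  \<open>U\<close> their homogeneous coordinates.\<close>

locale affine_coordinates = field F for F (structure) +
  fixes d :: nat
begin

sublocale V: vectorspace F "coord_space F d"
  by (rule coord_space_vectorspace) (rule field_axioms)

sublocale U: vectorspace F "coord_space F (Suc d)"
  by (rule coord_space_vectorspace) (rule field_axioms)

section \<open>Coordinatewise computation\<close>

lemma coord_space_simps:
  "carrier (coord_space F n) = {..<n} \<rightarrow>\<^sub>E carrier F"
  "\<zero>\<^bsub>coord_space F n\<^esub> = (\<lambda>i\<in>{..<n}. \<zero>)"
  "x \<oplus>\<^bsub>coord_space F n\<^esub> y = (\<lambda>i\<in>{..<n}. x i \<oplus> y i)"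
  "c \<odot>\<^bsub>coord_space F n\<^esub> x = (\<lambda>i\<in>{..<n}. c \<otimes> x i)"
  by (auto simp: coord_space_def func_space_def)

lemma coord_closed: "x \<in> carrier (coord_space F n) \<Longrightarrow> i < n \<Longrightarrow> x i \<in> carrier F"
  by (auto simp: coord_space_simps)

lemma coord_minus:
  assumes "x \<in> carrier (coord_space F n)" "y \<in> carrier (coord_space F n)" "i < n"
  shows "(x \<ominus>\<^bsub>coord_space F n\<^esub> y) i = x i \<ominus> y i"
proof -
  interpret N: vectorspace F "coord_space F n"
    by (rule coord_space_vectorspace) (rule field_axioms)
  have "(x \<ominus>\<^bsub>coord_space F n\<^esub> y) \<oplus>\<^bsub>coord_space F n\<^esub> y = x"
    using assms by (simp add: N.M.minus_eq N.M.add.m_assoc N.M.l_neg)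
  from fun_cong[OF this, of i] have "x i = (x \<ominus>\<^bsub>coord_space F n\<^esub> y) i \<oplus> y i"
    using assms(3) by (simp add: coord_space_simps(3))
  moreover have "(x \<ominus>\<^bsub>coord_space F n\<^esub> y) i \<in> carrier F" "y i \<in> carrier F"
    using assms coord_closed[OF N.M.minus_closed] coord_closed by auto
  ultimately show ?thesis by (simp add: minus_eq a_assoc r_neg)
qed

lemma coord_eqI:
  assumes "x \<in> carrier (coord_space F n)" "y \<in> carrier (coord_space F n)" "\<And>i. i < n \<Longrightarrow> x i = y i"
  shows "x = y"
  using assms by (auto simp: coord_space_simps intro: PiE_ext)

lemma coord_finsum:
  assumes "finite A" "f \<in> A \<rightarrow> carrier (coord_space F n)" "i < n"
  shows "(\<Oplus>\<^bsub>coord_space F n\<^esub>x\<in>A. f x) i = (\<Oplus>x\<in>A. f x i)"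
proof -
  interpret N: vectorspace F "coord_space F n"
    by (rule coord_space_vectorspace) (rule field_axioms)
  show ?thesis using assms
  proof (induction A rule: finite_induct)
    case empty
    then show ?case by (simp add: coord_space_simps)
  next
    case (insert a A)
    then have f: "f \<in> A \<rightarrow> carrier (coord_space F n)" "f a \<in> carrier (coord_space F n)" by auto
    then have "(\<lambda>x. f x i) \<in> A \<rightarrow> carrier F" "f a i \<in> carrier F"
      using coord_closed insert.prems by (auto simp: Pi_iff)
    then show ?case
      using insert f by (simp add: coord_space_simps(3))
  qed
qed

lemma coord_lincomb:
  assumes "finite A" "A \<subseteq> carrier (coord_space F n)" "a \<in> A \<rightarrow> carrier F" "i < n"
  shows "module.lincomb (coord_space F n) a A i = (\<Oplus>x\<in>A. a x \<otimes> x i)"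
proof -
  interpret N: vectorspace F "coord_space F n"
    by (rule coord_space_vectorspace) (rule field_axioms)
  have "N.lincomb a A i = (\<Oplus>x\<in>A. (a x \<odot>\<^bsub>coord_space F n\<^esub> x) i)"
    unfolding N.lincomb_def by (rule coord_finsum) (use assms in auto)
  also have "\<dots> = (\<Oplus>x\<in>A. a x \<otimes> x i)"
    by (rule finsum_cong') (use assms coord_closed[of _ n] in \<open>auto simp: coord_space_simps(4) Pi_iff subset_iff\<close>)
  finally show ?thesis .
qed

section \<open>Lifting points and relations\<close>

text \<open>The extra coordinate takes the index \<open>d\<close>, where points are
  \<open>undefined\<close>; so restriction to \<open>{..<d}\<close> inverts the lift.\<close>

definition lift :: "(nat \<Rightarrow> 'a) \<Rightarrow> nat \<Rightarrow> 'a" where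
  "lift p = p(d := \<one>)"

lemma lift_closed: "p \<in> carrier (coord_space F d) \<Longrightarrow> lift p \<in> carrier (coord_space F (Suc d))"
  by (auto simp: lift_def coord_space_simps PiE_def extensional_def less_Suc_eq)

lemma restrict_lift: "p \<in> carrier (coord_space F d) \<Longrightarrow> restrict (lift p) {..<d} = p"
  by (auto simp: lift_def coord_space_simps PiE_def extensional_def fun_eq_iff)

lemma inj_on_lift: "inj_on lift (carrier (coord_space F d))"
  by (rule inj_on_inverseI[where g = "\<lambda>u. restrict u {..<d}"]) (rule restrict_lift)

text \<open>Comparing the coordinates at index \<open>d\<close>, which are all one, forces the
  factor to be one.\<close>

lemma pairwise_nonparallel_lift:
  assumes "P \<subseteq> carrier (coord_space F d)"
  shows "U.pairwise_nonparallel (lift ` P)"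
proof -
  have "lift x \<noteq> \<zero>\<^bsub>coord_space F (Suc d)\<^esub>" for x
  proof
    assume "lift x = \<zero>\<^bsub>coord_space F (Suc d)\<^esub>"
    then have "lift x d = \<zero>" by (simp add: coord_space_simps)
    then show False by (simp add: lift_def)
  qed
  moreover have "lift y = lift x"
    if "x \<in> P" "y \<in> P" "l \<in> carrier F" and eq: "lift y = l \<odot>\<^bsub>coord_space F (Suc d)\<^esub> lift x" for x y l
  proof -
    have "lift y d = l \<otimes> lift x d" using eq by (simp add: coord_space_simps)
    then have "l = \<one>" using that by (simp add: lift_def)
    then show ?thesis using eq lift_closed assms that by auto
  qed
  ultimately show ?thesis
    unfolding U.pairwise_nonparallel_def using lift_closed assms by auto
qed

abbreviation differences :: "(nat \<Rightarrow> 'a) set \<Rightarrow> (nat \<Rightarrow> 'a) \<Rightarrow> (nat \<Rightarrow> 'a) set" where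
  "differences A x0 \<equiv> (\<lambda>x. x \<ominus>\<^bsub>coord_space F d\<^esub> x0) ` (A - {x0})"

lemma inj_on_minus:
  assumes "A \<subseteq> carrier (coord_space F d)" "x0 \<in> carrier (coord_space F d)"
  shows "inj_on (\<lambda>x. x \<ominus>\<^bsub>coord_space F d\<^esub> x0) A"
  by (rule inj_on_inverseI[where g = "\<lambda>v. v \<oplus>\<^bsub>coord_space F d\<^esub> x0"])
    (use assms in \<open>auto simp: V.M.minus_eq V.M.add.m_assoc V.M.l_neg subset_iff\<close>)

text \<open>The coefficients sum to zero, so the multiples of \<open>y x0\<close> cancel; the
  summand at \<open>x0\<close> is zero anyway.\<close>

lemma finsum_differences:
  assumes "finite A" "x0 \<in> A" "a \<in> A \<rightarrow> carrier F" "y \<in> A \<rightarrow> carrier F" "(\<Oplus>x\<in>A. a x) = \<zero>"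
  shows "(\<Oplus>x\<in>A - {x0}. a x \<otimes> (y x \<ominus> y x0)) = (\<Oplus>x\<in>A. a x \<otimes> y x)"
proof -
  have y0: "y x0 \<in> carrier F" "a x0 \<in> carrier F" using assms by auto
  have c: "\<And>x. x \<in> A \<Longrightarrow> a x \<in> carrier F" "\<And>x. x \<in> A \<Longrightarrow> y x \<in> carrier F" using assms by auto
  have "(\<Oplus>x\<in>A. a x \<otimes> (y x \<ominus> y x0)) = (\<Oplus>x\<in>A. a x \<otimes> y x \<oplus> a x \<otimes> (\<ominus> y x0))"
    by (rule finsum_cong') (use c y0 in \<open>auto simp: minus_eq r_distr\<close>)
  also have "\<dots> = (\<Oplus>x\<in>A. a x \<otimes> y x) \<oplus> (\<Oplus>x\<in>A. a x \<otimes> (\<ominus> y x0))"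
    by (rule finsum_addf) (use c y0 in auto)
  also have "(\<Oplus>x\<in>A. a x \<otimes> (\<ominus> y x0)) = (\<Oplus>x\<in>A. a x) \<otimes> (\<ominus> y x0)"
    by (rule finsum_ldistr[symmetric]) (use assms y0 in auto)
  also have "(\<Oplus>x\<in>A. a x \<otimes> y x) \<oplus> (\<Oplus>x\<in>A. a x) \<otimes> (\<ominus> y x0) = (\<Oplus>x\<in>A. a x \<otimes> y x)"
    using assms y0 c by simp
  finally have 1: "(\<Oplus>x\<in>A. a x \<otimes> (y x \<ominus> y x0)) = (\<Oplus>x\<in>A. a x \<otimes> y x)" .
  have "(\<Oplus>x\<in>insert x0 (A - {x0}). a x \<otimes> (y x \<ominus> y x0))
      = a x0 \<otimes> (y x0 \<ominus> y x0) \<oplus> (\<Oplus>x\<in>A - {x0}. a x \<otimes> (y x \<ominus> y x0))"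
    by (rule finsum_insert) (use assms c y0 in auto)
  also have "\<dots> = (\<Oplus>x\<in>A - {x0}. a x \<otimes> (y x \<ominus> y x0))"
    using y0 c by (simp add: minus_eq r_neg)
  finally show ?thesis using 1 assms(2) by (simp add: insert_absorb)
qed

text \<open>Coordinate \<open>d\<close> of a relation among lifts says that the coefficients sum to
  zero. Given this, the remaining coordinates agree with those of the combination of differences by
  \<open>finsum_differences\<close>. Restriction and adding \<open>x0\<close> carry the coefficients
  \<open>a\<close> of the points over to the two vector sets.\<close>

lemma lincomb_lift_eq_zero_iff:
  assumes A: "finite A" "A \<subseteq> carrier (coord_space F d)" "x0 \<in> A" and a: "a \<in> A \<rightarrow> carrier F"
  shows "U.lincomb (\<lambda>u. a (restrict u {..<d})) (lift ` A) = \<zero>\<^bsub>coord_space F (Suc d)\<^esub> \<longleftrightarrow>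
    (\<Oplus>x\<in>A. a x) = \<zero> \<and>
    V.lincomb (\<lambda>v. a (v \<oplus>\<^bsub>coord_space F d\<^esub> x0)) (differences A x0) = \<zero>\<^bsub>coord_space F d\<^esub>"
proof -
  have Ac: "x \<in> carrier (coord_space F d)" if "x \<in> A" for x using A that by auto
  have x0: "x0 \<in> carrier (coord_space F d)" using A by auto
  have ac: "a x \<in> carrier F" if "x \<in> A" for x using a that by auto
  let ?u = "U.lincomb (\<lambda>u. a (restrict u {..<d})) (lift ` A)"
  let ?v = "V.lincomb (\<lambda>v. a (v \<oplus>\<^bsub>coord_space F d\<^esub> x0)) (differences A x0)"
  have uc: "(\<lambda>u. a (restrict u {..<d})) \<in> lift ` A \<rightarrow> carrier F" "lift ` A \<subseteq> carrier (coord_space F (Suc d))"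
    using ac restrict_lift Ac lift_closed by auto
  have recover: "(x \<ominus>\<^bsub>coord_space F d\<^esub> x0) \<oplus>\<^bsub>coord_space F d\<^esub> x0 = x" if "x \<in> A" for x
    using Ac[OF that] x0 by (simp add: V.M.minus_eq V.M.add.m_assoc V.M.l_neg)
  have vc: "(\<lambda>v. a (v \<oplus>\<^bsub>coord_space F d\<^esub> x0)) \<in> differences A x0 \<rightarrow> carrier F"
    "differences A x0 \<subseteq> carrier (coord_space F d)"
    using ac recover Ac x0 by auto
  have ui: "?u i = (\<Oplus>x\<in>A. a x \<otimes> lift x i)" if "i < Suc d" for i
  proof -
    have "?u i = (\<Oplus>u\<in>lift ` A. a (restrict u {..<d}) \<otimes> u i)"
      by (rule coord_lincomb) (use A uc that in auto)
    also have "\<dots> = (\<Oplus>x\<in>A. a (restrict (lift x) {..<d}) \<otimes> lift x i)"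
      by (rule finsum_reindex)
        (use uc coord_closed[OF _ that] inj_on_subset[OF inj_on_lift] A in \<open>auto simp: Pi_iff subset_iff\<close>)
    also have "\<dots> = (\<Oplus>x\<in>A. a x \<otimes> lift x i)"
      by (rule finsum_cong') (use Ac ac restrict_lift lift_closed coord_closed[OF _ that] in auto)
    finally show ?thesis .
  qed
  have vi: "?v i = (\<Oplus>x\<in>A - {x0}. a x \<otimes> (x i \<ominus> x0 i))" if "i < d" for i
  proof -
    have "?v i = (\<Oplus>v\<in>differences A x0. a (v \<oplus>\<^bsub>coord_space F d\<^esub> x0) \<otimes> v i)"
      by (rule coord_lincomb) (use A vc that in auto)
    also have "\<dots> = (\<Oplus>x\<in>A - {x0}. a ((x \<ominus>\<^bsub>coord_space F d\<^esub> x0) \<oplus>\<^bsub>coord_space F d\<^esub> x0) \<otimes> (x \<ominus>\<^bsub>coord_space F d\<^esub> x0) i)"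
      by (rule finsum_reindex)
        (use vc coord_closed[OF _ that] inj_on_subset[OF inj_on_minus[OF A(2) x0]] in \<open>auto simp: Pi_iff subset_iff\<close>)
    also have "\<dots> = (\<Oplus>x\<in>A - {x0}. a x \<otimes> (x i \<ominus> x0 i))"
      by (rule finsum_cong') (use Ac ac x0 recover coord_closed[OF _ that] coord_minus[OF _ _ that] in auto)
    finally show ?thesis .
  qed
  have ud: "?u d = (\<Oplus>x\<in>A. a x)"
  proof -
    have "(\<Oplus>x\<in>A. a x \<otimes> lift x d) = (\<Oplus>x\<in>A. a x)"
      by (rule finsum_cong') (use ac in \<open>auto simp: lift_def\<close>)
    then show ?thesis using ui[of d] by simp
  qed
  have uv: "?u i = ?v i" if "i < d" "(\<Oplus>x\<in>A. a x) = \<zero>" for i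
  proof -
    have "(\<Oplus>x\<in>A - {x0}. a x \<otimes> (x i \<ominus> x0 i)) = (\<Oplus>x\<in>A. a x \<otimes> x i)"
      using finsum_differences[OF A(1,3) a _ that(2), of "\<lambda>x. x i"] Ac coord_closed[OF _ that(1)] by auto
    moreover have "lift x i = x i" for x using that by (simp add: lift_def)
    ultimately show ?thesis using ui[of i] vi[OF that(1)] that by simp
  qed
  have uC: "?u \<in> carrier (coord_space F (Suc d))" and vC: "?v \<in> carrier (coord_space F d)"
    using uc vc by auto
  show ?thesis
  proof safe
    assume "?u = \<zero>\<^bsub>coord_space F (Suc d)\<^esub>"
    then have z: "?u i = \<zero>" if "i < Suc d" for i using that by (simp add: coord_space_simps)
    then show s: "(\<Oplus>x\<in>A. a x) = \<zero>" using ud by simp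
    show "?v = \<zero>\<^bsub>coord_space F d\<^esub>"
      by (rule coord_eqI[OF vC]) (use uv[OF _ s] z in \<open>auto simp: coord_space_simps\<close>)
  next
    assume s: "(\<Oplus>x\<in>A. a x) = \<zero>" and v: "?v = \<zero>\<^bsub>coord_space F d\<^esub>"
    show "?u = \<zero>\<^bsub>coord_space F (Suc d)\<^esub>"
    proof (rule coord_eqI[OF uC])
      fix i assume "i < Suc d"
      then have "?u i = \<zero>" using uv[OF _ s, of i] ud s v by (cases "i = d") (auto simp: coord_space_simps)
      then show "?u i = \<zero>\<^bsub>coord_space F (Suc d)\<^esub> i" using \<open>i < Suc d\<close> by (simp add: coord_space_simps)
    qed simp
  qed
qed

text \<open>A relation among the differences from \<open>x0\<close> extends to a relation among the
  lifts, once \<open>x0\<close> receives the coefficient that makes the sum zero.\<close>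

lemma affinely_independent_of_lift:
  assumes A: "finite A" "A \<subseteq> carrier (coord_space F d)" and i: "U.lin_indpt (lift ` A)"
  shows "V.affinely_independent A"
  unfolding V.affinely_independent_def
proof (intro conjI ballI A(2))
  fix x0 assume x0: "x0 \<in> A"
  have x0c: "x0 \<in> carrier (coord_space F d)" using A x0 by auto
  have recover: "(x \<ominus>\<^bsub>coord_space F d\<^esub> x0) \<oplus>\<^bsub>coord_space F d\<^esub> x0 = x" if "x \<in> A" for x
    using A that x0c by (auto simp: V.M.minus_eq V.M.add.m_assoc V.M.l_neg subset_iff)
  show "V.lin_indpt (differences A x0)"
  proof (rule V.finite_lin_indpt2)
    fix c assume c: "c \<in> differences A x0 \<rightarrow> carrier F"
      and c0: "V.lincomb c (differences A x0) = \<zero>\<^bsub>coord_space F d\<^esub>"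
    define s where "s = (\<Oplus>x\<in>A - {x0}. c (x \<ominus>\<^bsub>coord_space F d\<^esub> x0))"
    define a where "a = (\<lambda>x. if x = x0 then \<ominus> s else c (x \<ominus>\<^bsub>coord_space F d\<^esub> x0))"
    have cc: "(\<lambda>x. c (x \<ominus>\<^bsub>coord_space F d\<^esub> x0)) \<in> A - {x0} \<rightarrow> carrier F" using c by auto
    have sc: "s \<in> carrier F" unfolding s_def using cc by (rule finsum_closed)
    have a: "a \<in> A \<rightarrow> carrier F" using sc cc by (auto simp: a_def)
    have "(\<Oplus>x\<in>insert x0 (A - {x0}). a x) = a x0 \<oplus> (\<Oplus>x\<in>A - {x0}. a x)"
      by (rule finsum_insert) (use A a x0 in auto)
    moreover have "(\<Oplus>x\<in>A - {x0}. a x) = s"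
      unfolding s_def by (rule finsum_cong') (use cc in \<open>auto simp: a_def\<close>)
    ultimately have "(\<Oplus>x\<in>A. a x) = \<zero>" using x0 sc by (simp add: insert_absorb a_def l_neg)
    moreover have "V.lincomb (\<lambda>v. a (v \<oplus>\<^bsub>coord_space F d\<^esub> x0)) (differences A x0) = V.lincomb c (differences A x0)"
      by (rule V.lincomb_cong) (use A x0c c recover in \<open>auto simp: a_def\<close>)
    ultimately have u0: "U.lincomb (\<lambda>u. a (restrict u {..<d})) (lift ` A) = \<zero>\<^bsub>coord_space F (Suc d)\<^esub>"
      using lincomb_lift_eq_zero_iff[OF A x0 a] c0 by simp
    have az: "a x = \<zero>" if "x \<in> A" for x
    proof -
      have "a (restrict (lift x) {..<d}) = \<zero>"
        by (rule U.lin_indptD[OF i _ _ u0]) (use A a that restrict_lift in \<open>auto simp: subset_iff\<close>)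
      then show ?thesis using restrict_lift A that by auto
    qed
    show "\<forall>v\<in>differences A x0. c v = \<zero>"
    proof
      fix v assume "v \<in> differences A x0"
      then obtain x where "x \<in> A" "x \<noteq> x0" "v = x \<ominus>\<^bsub>coord_space F d\<^esub> x0" by auto
      then show "c v = \<zero>" using az[of x] by (simp add: a_def)
    qed
  qed (use A x0c in auto)
qed

text \<open>The hyperplane passes through \<open>x0\<close>, and its direction is spanned by the
  differences of all points except \<open>x1\<close>. These are independent because the circuit
  without \<open>lift x1\<close> is, and the circuit relation, nonzero at \<open>x1\<close>, puts
  the last difference \<open>y\<close> into the same span.\<close>

lemma hyperplane_through_lifted_circuit:
  assumes T: "T \<subseteq> carrier (coord_space F d)" "card T = Suc d" "2 \<le> card T" and C: "U.circuit (lift ` T)"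
  shows "\<exists>H. hyperplane F d H \<and> T \<subseteq> H"
proof -
  have fT: "finite T" using T(2) card_ge_0_finite by force
  obtain x0 x1 where x: "x0 \<in> T" "x1 \<in> T" "x0 \<noteq> x1"
    using card_le_Suc0_iff_eq[OF fT] T(3) by force
  have x0: "x0 \<in> carrier (coord_space F d)" using x T by auto
  have Tc: "t \<in> carrier (coord_space F d)" if "t \<in> T" for t using that T by auto
  have recover: "(t \<ominus>\<^bsub>coord_space F d\<^esub> x0) \<oplus>\<^bsub>coord_space F d\<^esub> x0 = t" if "t \<in> T" for t
    using Tc[OF that] x0 by (simp add: V.M.minus_eq V.M.add.m_assoc V.M.l_neg)
  define y where "y = x1 \<ominus>\<^bsub>coord_space F d\<^esub> x0"
  define B where "B = differences (T - {x1}) x0"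
  have injd: "inj_on (\<lambda>t. t \<ominus>\<^bsub>coord_space F d\<^esub> x0) T" by (rule inj_on_minus[OF T(1) x0])
  have Bd: "B = differences T x0 - {y}"
    using injd x unfolding B_def y_def inj_on_def by blast
  have Dc: "differences T x0 \<subseteq> carrier (coord_space F d)" using Tc x0 by auto
  have Bc: "B \<subseteq> carrier (coord_space F d)" "finite B" using Dc fT by (auto simp: Bd)
  have "card B = card (T - {x1} - {x0})"
    unfolding B_def by (rule card_image) (rule inj_on_subset[OF injd], auto)
  \<comment> \<open>Of the \<open>d + 1\<close> points both \<open>x0\<close> and \<open>x1\<close>
    are left out, which gives the dimension of a hyperplane.\<close>
  then have cB: "card B = d - 1" using x T fT by simp
  have "lift ` T - {lift x1} = lift ` (T - {x1})"
    using inj_on_image_set_diff[OF inj_on_lift, of T "{x1}"] T(1) x(2) by auto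
  then have "U.lin_indpt (lift ` (T - {x1}))" using U.circuitD(4)[OF C, of "lift x1"] x by simp
  then have "V.affinely_independent (T - {x1})" by (rule affinely_independent_of_lift[rotated 2]) (use T fT in auto)
  then have iB: "V.lin_indpt B" using x by (auto simp: V.affinely_independent_def B_def)
  obtain b where b: "b \<in> lift ` T \<rightarrow> carrier F" "U.lincomb b (lift ` T) = \<zero>\<^bsub>coord_space F (Suc d)\<^esub>"
    "\<And>u. u \<in> lift ` T \<Longrightarrow> b u \<noteq> \<zero>"
    using U.circuit_relation[OF C] by blast
  define a where "a = (\<lambda>t. b (lift t))"
  have a: "a \<in> T \<rightarrow> carrier F" using b(1) by (auto simp: a_def)
  have "U.lincomb (\<lambda>u. a (restrict u {..<d})) (lift ` T) = U.lincomb b (lift ` T)"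
    by (rule U.lincomb_cong) (use b Tc lift_closed restrict_lift in \<open>auto simp: a_def\<close>)
  then have v0: "V.lincomb (\<lambda>v. a (v \<oplus>\<^bsub>coord_space F d\<^esub> x0)) (differences T x0) = \<zero>\<^bsub>coord_space F d\<^esub>"
    using lincomb_lift_eq_zero_iff[OF fT T(1) x(1) a] b(2) by simp
  have "y \<in> V.span (differences T x0 - {y})"
  proof (rule V.lincomb_isolate(2)[OF _ Dc _ _ _ v0])
    show "(\<lambda>v. a (v \<oplus>\<^bsub>coord_space F d\<^esub> x0)) \<in> differences T x0 \<rightarrow> carrier F" using a recover by auto
    show "a (y \<oplus>\<^bsub>coord_space F d\<^esub> x0) \<noteq> \<zero>" using recover[OF x(2)] b(3) x by (simp add: y_def a_def)
  qed (use fT x in \<open>auto simp: y_def\<close>)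
  then have yW: "y \<in> V.span B" by (simp add: Bd)
  define W where "W = V.span B"
  have sW: "VectorSpace.subspace F W (coord_space F d)"
    unfolding W_def by (rule V.span_is_subspace[OF Bc(1)])
  have mW: "submodule F W (coord_space F d)" using sW V.is_module by blast
  interpret W: vectorspace F "V.vs W" by (rule V.subspace_is_vs[OF sW])
  have BW: "B \<subseteq> W" unfolding W_def by (rule V.in_own_span[OF Bc(1)])
  have "W.basis B"
    unfolding W.basis_def using V.span_li_not_depend[OF BW mW] iB BW by (simp add: W_def)
  then have "W.fin_dim" "W.dim = d - 1"
    using W.dim_basis[OF Bc(2)] cB Bc(2) by (auto simp: W.fin_dim_def W.basis_def)
  then have "hyperplane F d ((\<lambda>w. x0 \<oplus>\<^bsub>coord_space F d\<^esub> w) ` W)"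
    unfolding hyperplane_def V.affine_subspace_of_dim_def using x0 sW by blast
  moreover have "T \<subseteq> (\<lambda>w. x0 \<oplus>\<^bsub>coord_space F d\<^esub> w) ` W"
  proof
    fix t assume t: "t \<in> T"
    have "t \<ominus>\<^bsub>coord_space F d\<^esub> x0 \<in> W"
    proof (cases "t = x0")
      case True
      then show ?thesis using x0 V.span_zero by (simp add: V.M.minus_eq V.M.r_neg W_def)
    next
      case False
      then have "t \<ominus>\<^bsub>coord_space F d\<^esub> x0 \<in> insert y B" using t by (auto simp: Bd)
      then show ?thesis using yW BW by (auto simp: W_def)
    qed
    moreover have "t = x0 \<oplus>\<^bsub>coord_space F d\<^esub> (t \<ominus>\<^bsub>coord_space F d\<^esub> x0)"
      using recover[OF t] Tc[OF t] x0 by (simp add: V.M.a_comm)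
    ultimately show "t \<in> (\<lambda>w. x0 \<oplus>\<^bsub>coord_space F d\<^esub> w) ` W" by blast
  qed
  ultimately show ?thesis by blast
qed

text \<open>A proper subset misses some point \<open>y\<close>, so its lift lies in the circuit
  without \<open>lift y\<close> and is independent.\<close>

lemma critical_coplanar_tuple_of_lifted_circuit:
  assumes T: "T \<subseteq> carrier (coord_space F d)" "card T = Suc d" "0 < d" and C: "U.circuit (lift ` T)"
  shows "critical_coplanar_tuple F d T"
  unfolding critical_coplanar_tuple_def coplanar_tuple_def
proof (intro conjI allI impI)
  show "card T = d + 1" using T by simp
  show "\<exists>H. hyperplane F d H \<and> T \<subseteq> H" using hyperplane_through_lifted_circuit[OF T(1,2) _ C] T by simp
  fix S assume S: "S \<subset> T"
  then obtain y where y: "y \<in> T" "S \<subseteq> T - {y}" by auto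
  have fT: "finite T" using T(2) card_ge_0_finite by force
  have "lift ` S \<subseteq> lift ` T - {lift y}"
    using y T(1) inj_on_lift unfolding inj_on_def by blast
  then have "U.lin_indpt (lift ` S)"
    using U.circuitD(4)[OF C, of "lift y"] U.subset_li_is_li y by blast
  then show "V.affinely_independent S"
    by (rule affinely_independent_of_lift[rotated 2]) (use S T fT finite_subset in auto)
qed

end

theorem theoremA1:
  fixes d :: nat
  assumes "d \<ge> 3"
  shows "\<exists>c :: real. c > 0 \<and>
    (\<forall>q :: nat. primepow q \<longrightarrow>
      (\<forall>F :: nat ring. field F \<and> card (carrier F) = q \<longrightarrow>
        (\<forall>P. P \<subseteq> carrier (coord_space F d) \<and> real (card P) \<ge> c * real q ^ (d - 2) \<longrightarrow>
          (\<exists>T \<subseteq> P. critical_coplanar_tuple F d T))))"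
proof -
  \<comment> \<open>This is the constant of \<open>exists_circuit_of_card\<close> for
    \<open>r = d + 1\<close>; the exponent \<open>r - 3\<close> is then \<open>d - 2\<close>, and
    \<open>c\<close> is chosen as \<open>real m\<close>, independent of \<open>q\<close> and
    \<open>F\<close>.\<close>
  define m where "m = 5 + Suc d + 2 * (Suc d)\<^sup>2"
  have "\<exists>T\<subseteq>P. critical_coplanar_tuple F d T"
    if q: "primepow q" "card (carrier F) = q" and F: "field F"
      and P: "P \<subseteq> carrier (coord_space F d)" "real (card P) \<ge> real m * real q ^ (d - 2)"
    for q and F :: "nat ring" and P
  proof -
    interpret affine_coordinates F d unfolding affine_coordinates_def by (rule F)
    have "m * q ^ (Suc d - 3) \<le> card P"
    proof -
      have "real (m * q ^ (d - 2)) \<le> real (card P)" using P(2) by simp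
      then show ?thesis using assms by (simp only: of_nat_le_iff) simp
    qed
    moreover have "card (lift ` P) = card P"
      by (rule card_image) (rule inj_on_subset[OF inj_on_lift P(1)])
    moreover have "card (carrier (coord_space F (Suc d))) = q ^ Suc d"
      using q by (simp add: coord_space_simps card_funcsetE)
    moreover have "2 \<le> q" using primepow_gt_Suc_0[OF q(1)] by simp
    ultimately obtain C where C: "C \<subseteq> lift ` P" "U.circuit C" "card C = Suc d"
      using U.exists_circuit_of_card[OF pairwise_nonparallel_lift[OF P(1)], of "Suc d" q] assms q(2)
      unfolding m_def by auto
    then obtain T where T: "T \<subseteq> P" "C = lift ` T" by (auto simp: subset_image_iff)
    have "card C = card T"
      unfolding T(2) by (rule card_image) (rule inj_on_subset[OF inj_on_lift], use T P in auto)
    then show ?thesis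
      using critical_coplanar_tuple_of_lifted_circuit[of T] T P C assms by auto
  qed
  moreover have "real m > 0" unfolding of_nat_0_less_iff by (simp add: m_def)
  ultimately show ?thesis by blast
qed

end
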